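(* Let $R=P/I_{\mathbb{X}}$ be the homogeneous coordinate ring of a $0$-dimensional subscheme $\mathbb{X}$ of $\mathbb{P}^n$ as in the context, and let $\epsilon:\Omega^1_{R/K}\to\mathfrak{m}$ be the Euler form. Then: (a) Let $\gamma: P^{n+1}\to\Omega^1_{R/K}$ be the $P$-module epimorphism defined by $\gamma(e_i)=dx_i$ for $i=0,\dots,n$, and let $\eta:\Omega^1_{R/K}\to\Omega^1_{R/K}/U_{R/K}$ be the canonical epimorphism. Then the composition $\delta=\eta\circ\gamma\circ\theta:\ \mathfrak{M}\to\Omega^1_{R/K}/U_{R/K}$ is a $P$-linear map, where $\theta:\mathfrak{M}\to P^{n+1}$ is the triangular decomposition map. (b) We have $\delta(I_{\mathbb{X}})=\mathrm{Ker}(\epsilon)/U_{R/K}$. (c) Given a homogeneous system of generators $\{G_1,\dots,G_r\}$ of $I_{\mathbb{X}}$, we have $\mathrm{Ker}(\epsilon)=U_{R/K}+\langle(\gamma\circ\theta)(G_1),\dots,(\gamma\circ\theta)(G_r)\rangle$. (d) Let $m_{\mathbb{X}}=\max\{i\ge0\mid (I_{\mathbb{X}}/\mathfrak{M}I_{\mathbb{X}})_i\ne0\}$ be the maximal degree of a homogeneous minimal generator of $I_{\mathbb{X}}$. Then $(U_{R/K})_i=\mathrm{Ker}(\epsilon)_i$ for all $i>m_{\mathbb{X}}$.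
   Context: Let $K$ be a perfect field, $n\ge 1$, $P=K[X_0,\dots,X_n]$ with the standard grading, $\mathfrak{M}=\langle X_0,\dots,X_n\rangle\subseteq P$, and $\mathbb{X}\subseteq\mathbb{P}^n$ a $0$-dimensional subscheme over $K$ with saturated homogeneous vanishing ideal $I_{\mathbb{X}}$. Put $R=P/I_{\mathbb{X}}$, let $x_i$ be the image of $X_i$ in $R$, and let $\mathfrak{m}=\langle x_0,\dots,x_n\rangle\subseteq R$. Assume no point of the support of $\mathbb{X}$ lies on the hyperplane $X_0=0$; then $x_0$ is a non-zerodivisor of $R$. $\Omega^1_{R/K}$ is the module of Kähler differentials, graded with $\deg(dx_i)=1$. The Euler form is the surjective $R$-linear map $\epsilon:\Omega^1_{R/K}\to\mathfrak{m}$ with $\epsilon(dx_i)=x_i$ for $i=0,\dots,n$. The Koszul submodule is $U_{R/K}=\langle x_i\,dx_j-x_j\,dx_i\mid 0\le i<j\le n\rangle\subseteq\Omega^1_{R/K}$. Triangular decomposition: every $F\in\mathfrak{M}$ has a unique decomposition $F=F_0X_0+\cdots+F_nX_n$ with $F_i\in K[X_i,\dots,X_n]$ for $i=0,\dots,n$. The $K$-linear map $\theta:\mathfrak{M}\to P^{n+1}$ is defined by $\theta(F)=(F_0,\dots,F_n)$. The standard basis of $P^{n+1}$ is $e_0,\dots,e_n$. *)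

theory Defs
  imports
    "HOL-Algebra.QuotRing"
    "HOL-Algebra.Module"
    "HOL-Algebra.Ideal_Product"
    "HOL-Library.Poly_Mapping"
    "HOL-Library.Extended_Real"
begin

section \<open>Modules over a commutative ring\<close>

definition ring_module :: "('a, 'm) ring_scheme \<Rightarrow> ('a, 'a) module" where
  "ring_module R = \<lparr>carrier = carrier R, monoid.mult = monoid.mult R, one = one R, zero = zero R,
     add = add R, smult = monoid.mult R\<rparr>"

text \<open>Finitely supported functions \<open>A \<rightarrow> R\<close>, extended by zero outside \<open>A\<close>. Here and below, the
  fields \<open>mult\<close> and \<open>one\<close>, which the record of modules inherits from rings, carry no meaning.\<close>

definition free_module :: "('a, 'm) ring_scheme \<Rightarrow> 'i set \<Rightarrow> ('a, 'i \<Rightarrow> 'a) module" where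
  "free_module R A =
     \<lparr>carrier = {v. (\<forall>a\<in>A. v a \<in> carrier R) \<and> (\<forall>a. a \<notin> A \<longrightarrow> v a = \<zero>\<^bsub>R\<^esub>)
        \<and> finite {a. v a \<noteq> \<zero>\<^bsub>R\<^esub>}},
      monoid.mult = (\<lambda>_ _. undefined), one = undefined,
      zero = (\<lambda>_. \<zero>\<^bsub>R\<^esub>),
      add = (\<lambda>v w a. v a \<oplus>\<^bsub>R\<^esub> w a),
      smult = (\<lambda>r v a. r \<otimes>\<^bsub>R\<^esub> v a)\<rparr>"

definition basis_vec :: "('a, 'm) ring_scheme \<Rightarrow> 'i \<Rightarrow> 'i \<Rightarrow> 'a" where
  "basis_vec R a = (\<lambda>b. if b = a then \<one>\<^bsub>R\<^esub> else \<zero>\<^bsub>R\<^esub>)"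

definition quot_module :: "('a, 'b) module \<Rightarrow> 'b set \<Rightarrow> ('a, 'b set) module" where
  "quot_module M N =
     \<lparr>carrier = a_rcosets\<^bsub>M\<^esub> N,
      monoid.mult = (\<lambda>_ _. undefined), one = undefined,
      zero = N,
      add = set_add M,
      smult = (\<lambda>r C. \<Union>x\<in>C. N +>\<^bsub>M\<^esub> (r \<odot>\<^bsub>M\<^esub> x))\<rparr>"

definition restrict_scalars :: "('p \<Rightarrow> 'a) \<Rightarrow> ('a, 'b) module \<Rightarrow> ('p, 'b) module" where
  "restrict_scalars \<phi> M =
     \<lparr>carrier = carrier M, monoid.mult = monoid.mult M, one = one M, zero = zero M, add = add M,
      smult = (\<lambda>p x. \<phi> p \<odot>\<^bsub>M\<^esub> x)\<rparr>"

definition mod_span :: "('a, 'm) ring_scheme \<Rightarrow> ('a, 'b) module \<Rightarrow> 'b set \<Rightarrow> 'b set" where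
  "mod_span R M S = \<Inter> {N. submodule N R M \<and> S \<subseteq> N}"

definition lin_maps ::
  "('a, 'm) ring_scheme \<Rightarrow> ('a, 'b) module \<Rightarrow> ('a, 'c) module \<Rightarrow> ('b \<Rightarrow> 'c) set" where
  "lin_maps R M N = {h. h \<in> carrier M \<rightarrow> carrier N
     \<and> (\<forall>x\<in>carrier M. \<forall>y\<in>carrier M. h (x \<oplus>\<^bsub>M\<^esub> y) = h x \<oplus>\<^bsub>N\<^esub> h y)
     \<and> (\<forall>r\<in>carrier R. \<forall>x\<in>carrier M. h (r \<odot>\<^bsub>M\<^esub> x) = r \<odot>\<^bsub>N\<^esub> h x)}"


section \<open>Kaehler differentials\<close>

text \<open>For a commutative ring \<open>R\<close> that is an algebra over a ring with image \<open>C \<subseteq> R\<close>: the free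
  \<open>R\<close>-module on symbols \<open>d a\<close> (\<open>a \<in> R\<close>) modulo additivity, the Leibniz rule and \<open>d c = 0\<close>
  for \<open>c \<in> C\<close>.\<close>

definition kaehler_relations :: "('a, 'm) ring_scheme \<Rightarrow> 'a set \<Rightarrow> ('a \<Rightarrow> 'a) set" where
  "kaehler_relations R C =
    (let F = free_module R (carrier R); e = basis_vec R in
      {e (a \<oplus>\<^bsub>R\<^esub> b) \<ominus>\<^bsub>F\<^esub> (e a \<oplus>\<^bsub>F\<^esub> e b) | a b. a \<in> carrier R \<and> b \<in> carrier R}
      \<union> {e (a \<otimes>\<^bsub>R\<^esub> b) \<ominus>\<^bsub>F\<^esub> (a \<odot>\<^bsub>F\<^esub> e b \<oplus>\<^bsub>F\<^esub> b \<odot>\<^bsub>F\<^esub> e a) | a b. a \<in> carrier R \<and> b \<in> carrier R}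
      \<union> e ` C)"

definition kaehler_rel_module :: "('a, 'm) ring_scheme \<Rightarrow> 'a set \<Rightarrow> ('a \<Rightarrow> 'a) set" where
  "kaehler_rel_module R C = mod_span R (free_module R (carrier R)) (kaehler_relations R C)"

definition kaehler :: "('a, 'm) ring_scheme \<Rightarrow> 'a set \<Rightarrow> ('a, ('a \<Rightarrow> 'a) set) module" where
  "kaehler R C = quot_module (free_module R (carrier R)) (kaehler_rel_module R C)"

definition kaehler_d :: "('a, 'm) ring_scheme \<Rightarrow> 'a set \<Rightarrow> 'a \<Rightarrow> ('a \<Rightarrow> 'a) set" where
  "kaehler_d R C a = kaehler_rel_module R C +>\<^bsub>free_module R (carrier R)\<^esub> basis_vec R a"


section \<open>The polynomial ring \<open>P = K[X\<^sub>0, \<dots>, X\<^sub>n]\<close>\<close>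

definition is_perfect_field :: "'k::field itself \<Rightarrow> bool" where
  "is_perfect_field _ \<longleftrightarrow> CHAR('k) = 0 \<or> (\<forall>x::'k. \<exists>y. y ^ CHAR('k) = x)"

type_synonym 'k mpoly = "(nat \<Rightarrow>\<^sub>0 nat) \<Rightarrow>\<^sub>0 'k"

definition polys_in :: "nat set \<Rightarrow> 'k::field mpoly set" where
  "polys_in V = {f. \<forall>m\<in>Poly_Mapping.keys f. Poly_Mapping.keys m \<subseteq> V}"

definition PR :: "nat \<Rightarrow> 'k::field mpoly ring" where
  "PR n = \<lparr>carrier = polys_in {0..n}, monoid.mult = (*), one = 1, zero = 0, add = (+)\<rparr>"

definition X :: "nat \<Rightarrow> 'k::field mpoly" where
  "X i = Poly_Mapping.single (Poly_Mapping.single i 1) 1"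

definition const :: "'k::field \<Rightarrow> 'k mpoly" where
  "const c = Poly_Mapping.single 0 c"

definition mdeg :: "(nat \<Rightarrow>\<^sub>0 nat) \<Rightarrow> nat" where
  "mdeg m = (\<Sum>i\<in>Poly_Mapping.keys m. Poly_Mapping.lookup m i)"

definition homogeneous :: "nat \<Rightarrow> 'k::field mpoly \<Rightarrow> bool" where
  "homogeneous d f \<longleftrightarrow> (\<forall>m\<in>Poly_Mapping.keys f. mdeg m = d)"

definition hom_comp :: "nat \<Rightarrow> 'k::field mpoly \<Rightarrow> 'k mpoly" where
  "hom_comp d f = (\<Sum>m\<in>{m\<in>Poly_Mapping.keys f. mdeg m = d}.
     Poly_Mapping.single m (Poly_Mapping.lookup f m))"

definition homogeneous_ideal :: "nat \<Rightarrow> 'k::field mpoly set \<Rightarrow> bool" where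
  "homogeneous_ideal n I \<longleftrightarrow> ideal I (PR n) \<and> (\<forall>f\<in>I. \<forall>d. hom_comp d f \<in> I)"

definition irrelevant :: "nat \<Rightarrow> 'k::field mpoly set" where
  "irrelevant n = Idl\<^bsub>PR n\<^esub> (X ` {0..n})"

definition ideal_power :: "nat \<Rightarrow> 'k::field mpoly set \<Rightarrow> nat \<Rightarrow> 'k mpoly set" where
  "ideal_power n J k = ((\<lambda>L. ideal_prod (PR n) J L) ^^ k) (carrier (PR n))"

definition saturation :: "nat \<Rightarrow> 'k::field mpoly set \<Rightarrow> 'k mpoly set" where
  "saturation n I =
     {f \<in> carrier (PR n). \<exists>k. \<forall>g\<in>ideal_power n (irrelevant n) k. g * f \<in> I}"


section \<open>\<open>0\<close>-dimensional subschemes of projective space\<close>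

text \<open>Closed subschemes of \<open>\<PP>\<^sup>n\<close> over \<open>K\<close> are represented by their saturated homogeneous vanishing
  ideals. The points of the scheme \<open>Proj (P/I)\<close> are the homogeneous primes of \<open>P\<close> that contain \<open>I\<close>
  but not the irrelevant ideal; its dimension is the supremum of the lengths of chains of points,
  and \<open>- \<infinity>\<close> for the empty scheme.\<close>

definition proj_points :: "nat \<Rightarrow> 'k::field mpoly set \<Rightarrow> 'k mpoly set set" where
  "proj_points n I = {p. primeideal p (PR n) \<and> homogeneous_ideal n p \<and> I \<subseteq> p
     \<and> \<not> irrelevant n \<subseteq> p}"

definition proj_dim :: "nat \<Rightarrow> 'k::field mpoly set \<Rightarrow> ereal" where
  "proj_dim n I = (SUP l \<in> {l. \<exists>p. (\<forall>i\<le>l. p i \<in> proj_points n I) \<and> (\<forall>i<l. p i \<subset> p (Suc i))}.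
     ereal (real l))"

definition zero_dim_subscheme :: "nat \<Rightarrow> 'k::field mpoly set \<Rightarrow> bool" where
  "zero_dim_subscheme n I \<longleftrightarrow>
     homogeneous_ideal n I \<and> saturation n I = I \<and> proj_dim n I = 0"


section \<open>The homogeneous coordinate ring and its differentials\<close>

definition coord_ring :: "nat \<Rightarrow> 'k::field mpoly set \<Rightarrow> 'k mpoly set ring" where
  "coord_ring n I = PR n Quot I"

definition cls :: "nat \<Rightarrow> 'k::field mpoly set \<Rightarrow> 'k mpoly \<Rightarrow> 'k mpoly set" where
  "cls n I f = I +>\<^bsub>PR n\<^esub> f"

definition coord_deg :: "nat \<Rightarrow> 'k::field mpoly set \<Rightarrow> nat \<Rightarrow> 'k mpoly set set" where
  "coord_deg n I d = cls n I ` {f \<in> carrier (PR n). homogeneous d f}"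

definition coord_max :: "nat \<Rightarrow> 'k::field mpoly set \<Rightarrow> 'k mpoly set set" where
  "coord_max n I = Idl\<^bsub>coord_ring n I\<^esub> ((\<lambda>i. cls n I (X i)) ` {0..n})"

definition Omega ::
  "nat \<Rightarrow> 'k::field mpoly set \<Rightarrow> ('k mpoly set, ('k mpoly set \<Rightarrow> 'k mpoly set) set) module" where
  "Omega n I = kaehler (coord_ring n I) (cls n I ` range const)"

definition dx ::
  "nat \<Rightarrow> 'k::field mpoly set \<Rightarrow> nat \<Rightarrow> ('k mpoly set \<Rightarrow> 'k mpoly set) set" where
  "dx n I i = kaehler_d (coord_ring n I) (cls n I ` range const) (cls n I (X i))"

text \<open>The grading of \<open>\<Omega>\<close> for which \<open>dx\<^sub>0, \<dots>, dx\<^sub>n\<close> have degree one.\<close>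

definition Omega_deg ::
  "nat \<Rightarrow> 'k::field mpoly set \<Rightarrow> nat \<Rightarrow> ('k mpoly set \<Rightarrow> 'k mpoly set) set set" where
  "Omega_deg n I i = (case i of
      0 \<Rightarrow> {\<zero>\<^bsub>Omega n I\<^esub>}
    | Suc d \<Rightarrow> {(\<Oplus>\<^bsub>Omega n I\<^esub>j\<in>{0..n}. r j \<odot>\<^bsub>Omega n I\<^esub> dx n I j) | r.
        \<forall>j\<in>{0..n}. r j \<in> coord_deg n I d})"

text \<open>The map is cut down to an extensional function (\<open>undefined\<close> outside \<open>\<Omega>\<close>) because
  \<open>R\<close>-linearity determines it only on \<open>\<Omega>\<close>.\<close>

definition euler_form ::
  "nat \<Rightarrow> 'k::field mpoly set \<Rightarrow> ('k mpoly set \<Rightarrow> 'k mpoly set) set \<Rightarrow> 'k mpoly set" where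
  "euler_form n I = (THE h.
     h \<in> lin_maps (coord_ring n I) (Omega n I)
           ((ring_module (coord_ring n I))\<lparr>carrier := coord_max n I\<rparr>)
     \<and> h \<in> extensional (carrier (Omega n I))
     \<and> (\<forall>i\<in>{0..n}. h (dx n I i) = cls n I (X i)))"

definition Ker_euler ::
  "nat \<Rightarrow> 'k::field mpoly set \<Rightarrow> ('k mpoly set \<Rightarrow> 'k mpoly set) set set" where
  "Ker_euler n I = a_kernel (Omega n I)
     ((ring_module (coord_ring n I))\<lparr>carrier := coord_max n I\<rparr>) (euler_form n I)"

definition koszul ::
  "nat \<Rightarrow> 'k::field mpoly set \<Rightarrow> ('k mpoly set \<Rightarrow> 'k mpoly set) set set" where
  "koszul n I = mod_span (coord_ring n I) (Omega n I)
     {(cls n I (X i) \<odot>\<^bsub>Omega n I\<^esub> dx n I j) \<ominus>\<^bsub>Omega n I\<^esub> (cls n I (X j) \<odot>\<^bsub>Omega n I\<^esub> dx n I i)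
       | i j. i < j \<and> j \<le> n}"

abbreviation Omega_mod_koszul where
  "Omega_mod_koszul n I \<equiv> quot_module (Omega n I) (koszul n I)"


section \<open>The triangular decomposition and the maps built from it\<close>

definition theta :: "nat \<Rightarrow> 'k::field mpoly \<Rightarrow> nat \<Rightarrow> 'k mpoly" where
  "theta n F = (THE v. v \<in> carrier (free_module (PR n) {0..n})
     \<and> (\<forall>i\<in>{0..n}. v i \<in> polys_in {i..n}) \<and> F = (\<Sum>i=0..n. v i * X i))"

definition gamma ::
  "nat \<Rightarrow> 'k::field mpoly set \<Rightarrow> (nat \<Rightarrow> 'k mpoly) \<Rightarrow> ('k mpoly set \<Rightarrow> 'k mpoly set) set" where
  "gamma n I v = (\<Oplus>\<^bsub>Omega n I\<^esub>i\<in>{0..n}. cls n I (v i) \<odot>\<^bsub>Omega n I\<^esub> dx n I i)"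

definition eta ::
  "nat \<Rightarrow> 'k::field mpoly set \<Rightarrow> ('k mpoly set \<Rightarrow> 'k mpoly set) set
     \<Rightarrow> ('k mpoly set \<Rightarrow> 'k mpoly set) set set" where
  "eta n I \<omega> = koszul n I +>\<^bsub>Omega n I\<^esub> \<omega>"

definition delta ::
  "nat \<Rightarrow> 'k::field mpoly set \<Rightarrow> 'k mpoly \<Rightarrow> ('k mpoly set \<Rightarrow> 'k mpoly set) set set" where
  "delta n I = eta n I \<circ> gamma n I \<circ> theta n"


section \<open>The maximal degree of a minimal generator\<close>

definition min_gens_module :: "nat \<Rightarrow> 'k::field mpoly set \<Rightarrow> ('k mpoly, 'k mpoly set) module" where
  "min_gens_module n I =
     quot_module ((ring_module (PR n))\<lparr>carrier := I\<rparr>) (ideal_prod (PR n) (irrelevant n) I)"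

definition min_gens_deg :: "nat \<Rightarrow> 'k::field mpoly set \<Rightarrow> nat \<Rightarrow> 'k mpoly set set" where
  "min_gens_deg n I i =
     (\<lambda>f. ideal_prod (PR n) (irrelevant n) I +>\<^bsub>PR n\<^esub> f) ` {f \<in> I. homogeneous i f}"

text \<open>The set below is finite and nonempty for the ideals \<open>I\<close> under consideration: \<open>P\<close> is noetherian
  and \<open>0 \<noteq> I \<noteq> P\<close>.\<close>

definition max_gen_degree :: "nat \<Rightarrow> 'k::field mpoly set \<Rightarrow> nat" where
  "max_gen_degree n I = Max {i. min_gens_deg n I i \<noteq> {\<zero>\<^bsub>min_gens_module n I\<^esub>}}"

end

theory Submission
  imports Defs
begin

text \<open>Every tuple \<open>v \<in> P\<^sup>n\<^sup>+\<^sup>1\<close> is congruent, modulo Koszul relations, to the triangular tuple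
  \<open>\<theta>(\<Sum>\<^sub>i v\<^sub>i X\<^sub>i)\<close>: for a monomial \<open>m e\<^sub>j\<close> one relation suffices. Hence \<open>\<eta>(\<gamma>(v)) = \<delta>(\<Sum>\<^sub>i v\<^sub>i X\<^sub>i)\<close>, so
  any decomposition may be used to compute \<open>\<delta>\<close>, which gives linearity. As \<open>\<epsilon>(\<gamma>(v))\<close> is the class of
  \<open>\<Sum>\<^sub>i v\<^sub>i X\<^sub>i\<close>, the kernel of \<open>\<epsilon>\<close> modulo \<open>U\<close> is \<open>\<delta>(I)\<close>, and generators of \<open>I\<close> give generators of it.
  Decomposing \<open>G F\<close> for \<open>F \<in> I\<close> as \<open>\<Sum>\<^sub>i (F G\<^sub>i) X\<^sub>i\<close> shows that \<open>\<delta>\<close> kills \<open>\<MM>I\<close>, which is all of \<open>I\<close> in degrees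
  above \<open>m\<^sub>X\<close>.\<close>

section \<open>Free modules, spans and quotient modules\<close>

text \<open>Three points shape the work. \<open>Omega\<close> is presented by one symbol for every
  element of \<open>R\<close>, so neither its generation by the \<open>dx n I i\<close> nor the
  existence of the Euler form is immediate. The former follows from the Leibniz rule. The latter
  rests on the Euler derivation, which multiplies a form of degree \<open>d\<close> by
  \<open>d\<close>: it maps a homogeneous ideal into itself, hence descends to \<open>R\<close>, and
  the universal property turns it into a linear map; this works in every characteristic. Next,
  \<open>theta\<close> is additive but not \<open>P\<close>-linear, since multiplying a triangular
  tuple can destroy triangularity. Statements about multiples are therefore made modulo
  \<open>koszul\<close>, where the choice of decomposition is invisible. Finally,
  \<open>max_gen_degree\<close> is a \<open>Max\<close>, which bounds anything only if the set of
  degrees is finite, so finiteness has to be proved and not just assumed from the noetherian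
  property of \<open>P\<close>.\<close>

lemma free_module_sel [simp]:
  "v \<oplus>\<^bsub>free_module R A\<^esub> w = (\<lambda>a. v a \<oplus>\<^bsub>R\<^esub> w a)"
  "r \<odot>\<^bsub>free_module R A\<^esub> v = (\<lambda>a. r \<otimes>\<^bsub>R\<^esub> v a)"
  "\<zero>\<^bsub>free_module R A\<^esub> = (\<lambda>_. \<zero>\<^bsub>R\<^esub>)"
  by (simp_all add: free_module_def)

lemma free_module_carrier:
  "v \<in> carrier (free_module R A) \<longleftrightarrow> (\<forall>a\<in>A. v a \<in> carrier R) \<and> (\<forall>a. a \<notin> A \<longrightarrow> v a = \<zero>\<^bsub>R\<^esub>)
     \<and> finite {a. v a \<noteq> \<zero>\<^bsub>R\<^esub>}"
  by (simp add: free_module_def)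

lemma (in cring) free_module_val:
  "v \<in> carrier (free_module R A) \<Longrightarrow> v a \<in> carrier R"
  by (cases "a \<in> A") (auto simp: free_module_carrier)

lemma (in cring) free_module_is_module: "Module.module R (free_module R A)"
proof (rule Module.moduleI)
  note [simp] = free_module_val
  show "abelian_group (free_module R A)"
  proof (rule abelian_groupI)
    fix v w assume v: "v \<in> carrier (free_module R A)" and w: "w \<in> carrier (free_module R A)"
    have "{a. v a \<oplus> w a \<noteq> \<zero>} \<subseteq> {a. v a \<noteq> \<zero>} \<union> {a. w a \<noteq> \<zero>}"
      by auto
    then show "v \<oplus>\<^bsub>free_module R A\<^esub> w \<in> carrier (free_module R A)"
      using v w by (auto simp: free_module_carrier intro: finite_subset)
    show "v \<oplus>\<^bsub>free_module R A\<^esub> w = w \<oplus>\<^bsub>free_module R A\<^esub> v"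
      using v w by (auto simp: a_comm)
  next
    fix v assume v: "v \<in> carrier (free_module R A)"
    have "{a. \<ominus> v a \<noteq> \<zero>} \<subseteq> {a. v a \<noteq> \<zero>}"
      by auto
    then have "(\<lambda>a. \<ominus> v a) \<in> carrier (free_module R A)"
      using v by (auto simp: free_module_carrier intro: finite_subset)
    moreover have "(\<lambda>a. \<ominus> v a) \<oplus>\<^bsub>free_module R A\<^esub> v = \<zero>\<^bsub>free_module R A\<^esub>"
      using v by (auto simp: l_neg)
    ultimately show "\<exists>w\<in>carrier (free_module R A). w \<oplus>\<^bsub>free_module R A\<^esub> v = \<zero>\<^bsub>free_module R A\<^esub>"
      by blast
  qed (auto simp: free_module_carrier a_assoc)
next
  fix r v assume r: "r \<in> carrier R" and v: "v \<in> carrier (free_module R A)"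
  have "{a. r \<otimes> v a \<noteq> \<zero>} \<subseteq> {a. v a \<noteq> \<zero>}"
    using r by auto
  then show "r \<odot>\<^bsub>free_module R A\<^esub> v \<in> carrier (free_module R A)"
    using r v by (auto simp: free_module_carrier intro: finite_subset)
qed (auto simp: free_module_val l_distr r_distr m_assoc is_cring)

lemma (in cring) basis_vec_carrier:
  "a \<in> A \<Longrightarrow> basis_vec R a \<in> carrier (free_module R A)"
  by (auto simp: free_module_carrier basis_vec_def)

text \<open>The record of \<open>M\<close> is fixed to have no further fields, which is the type
  that \<open>mod_span\<close>, \<open>lin_maps\<close> and \<open>quot_module\<close>
  demand.\<close>

locale plain_module = Module.module R M
  for R :: "('a, 'm) ring_scheme" and M :: "('a, 'b) module"
begin

lemma minus_eq_zero_iff: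
  assumes "x \<in> carrier M" "y \<in> carrier M"
  shows "x \<ominus>\<^bsub>M\<^esub> y = \<zero>\<^bsub>M\<^esub> \<longleftrightarrow> x = y"
proof
  assume "x \<ominus>\<^bsub>M\<^esub> y = \<zero>\<^bsub>M\<^esub>"
  moreover have "x = (x \<oplus>\<^bsub>M\<^esub> \<ominus>\<^bsub>M\<^esub> y) \<oplus>\<^bsub>M\<^esub> y"
    using assms by (simp add: M.a_assoc M.l_neg)
  ultimately show "x = y" using assms by (simp add: a_minus_def)
qed (use assms in \<open>simp add: a_minus_def M.r_neg\<close>)

lemma submodule_zero: "submodule N R M \<Longrightarrow> \<zero>\<^bsub>M\<^esub> \<in> N"
  using subgroup.one_closed[of N "add_monoid M"] by (simp add: submodule_def)

lemma mod_span_submodule: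
  assumes "S \<subseteq> carrier M" shows "submodule (mod_span R M S) R M"
proof (rule submoduleI)
  show "mod_span R M S \<subseteq> carrier M"
    unfolding mod_span_def using carrier_is_submodule assms by blast
next
  show "\<zero>\<^bsub>M\<^esub> \<in> mod_span R M S"
    unfolding mod_span_def using submodule_zero by blast
qed (auto simp: mod_span_def dest: submoduleE)

lemma mod_span_superset: "S \<subseteq> mod_span R M S"
  unfolding mod_span_def by blast

lemma mod_span_least: "submodule N R M \<Longrightarrow> S \<subseteq> N \<Longrightarrow> mod_span R M S \<subseteq> N"
  unfolding mod_span_def by blast

end

lemma (in plain_module) submodule_set_add:
  assumes A: "submodule A R M" and B: "submodule B R M"
  shows "submodule (A <+>\<^bsub>M\<^esub> B) R M"
proof -
  note AM = subsetD[OF submoduleE(1)[OF A]] and BM = subsetD[OF submoduleE(1)[OF B]]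
  have mem: "x \<in> A <+>\<^bsub>M\<^esub> B \<longleftrightarrow> (\<exists>a\<in>A. \<exists>b\<in>B. x = a \<oplus>\<^bsub>M\<^esub> b)" for x
    by (auto simp: set_add_def')
  show ?thesis
  proof (rule submoduleI)
    show "A <+>\<^bsub>M\<^esub> B \<subseteq> carrier M" using AM BM by (auto simp: mem)
    show "\<zero>\<^bsub>M\<^esub> \<in> A <+>\<^bsub>M\<^esub> B"
      unfolding mem by (intro bexI[OF _ submodule_zero[OF A]] bexI[OF _ submodule_zero[OF B]]) simp
  next
    fix x assume "x \<in> A <+>\<^bsub>M\<^esub> B"
    then obtain a b where ab: "a \<in> A" "b \<in> B" "x = a \<oplus>\<^bsub>M\<^esub> b" unfolding mem by blast
    then have "\<ominus>\<^bsub>M\<^esub> x = \<ominus>\<^bsub>M\<^esub> a \<oplus>\<^bsub>M\<^esub> \<ominus>\<^bsub>M\<^esub> b"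
      using AM BM by (simp add: M.minus_add)
    then show "\<ominus>\<^bsub>M\<^esub> x \<in> A <+>\<^bsub>M\<^esub> B"
      unfolding mem using submoduleE(3)[OF A ab(1)] submoduleE(3)[OF B ab(2)] by blast
  next
    fix x y assume "x \<in> A <+>\<^bsub>M\<^esub> B" "y \<in> A <+>\<^bsub>M\<^esub> B"
    then obtain a b a' b' where ab: "a \<in> A" "b \<in> B" "x = a \<oplus>\<^bsub>M\<^esub> b"
        "a' \<in> A" "b' \<in> B" "y = a' \<oplus>\<^bsub>M\<^esub> b'"
      unfolding mem by blast
    then have "x \<oplus>\<^bsub>M\<^esub> y = (a \<oplus>\<^bsub>M\<^esub> a') \<oplus>\<^bsub>M\<^esub> (b \<oplus>\<^bsub>M\<^esub> b')"
      using AM BM by (simp add: M.a_ac)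
    then show "x \<oplus>\<^bsub>M\<^esub> y \<in> A <+>\<^bsub>M\<^esub> B"
      unfolding mem using submoduleE(5)[OF A ab(1,4)] submoduleE(5)[OF B ab(2,5)] by blast
  next
    fix r x assume r: "r \<in> carrier R" and "x \<in> A <+>\<^bsub>M\<^esub> B"
    then obtain a b where ab: "a \<in> A" "b \<in> B" "x = a \<oplus>\<^bsub>M\<^esub> b" unfolding mem by blast
    then have "r \<odot>\<^bsub>M\<^esub> x = r \<odot>\<^bsub>M\<^esub> a \<oplus>\<^bsub>M\<^esub> r \<odot>\<^bsub>M\<^esub> b"
      using AM BM r by (simp add: smult_r_distr)
    then show "r \<odot>\<^bsub>M\<^esub> x \<in> A <+>\<^bsub>M\<^esub> B"
      unfolding mem using submoduleE(4)[OF A r ab(1)] submoduleE(4)[OF B r ab(2)] by blast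
  qed
qed

section \<open>The quotient by a submodule as a module of cosets\<close>

locale quotient_module = plain_module R M for R :: "('a, 'm) ring_scheme" and M :: "('a, 'b) module" +
  fixes N :: "'b set"
  assumes submodule_N: "submodule N R M"
begin

abbreviation "Q \<equiv> quot_module M N"
abbreviation proj where "proj x \<equiv> N +>\<^bsub>M\<^esub> x"

sublocale N: abelian_subgroup N M
  by (meson M.abelian_group_axioms abelian_subgroupI3 additive_subgroup.intro submodule.axioms(1)
      submodule_N)

lemma quot_carrier: "carrier Q = proj ` carrier M"
  by (auto simp: quot_module_def A_RCOSETS_def')

lemma quot_zero: "\<zero>\<^bsub>Q\<^esub> = N"
  by (simp add: quot_module_def)

lemma proj_closed: "x \<in> carrier M \<Longrightarrow> proj x \<in> carrier Q"
  by (simp add: quot_carrier)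

lemma proj_eq_iff:
  assumes "x \<in> carrier M" "y \<in> carrier M"
  shows "proj x = proj y \<longleftrightarrow> x \<ominus>\<^bsub>M\<^esub> y \<in> N"
proof
  assume "proj x = proj y"
  then have "proj (x \<ominus>\<^bsub>M\<^esub> y) = N"
    using M.a_coset_add_inv2[OF _ assms N.a_subset] by (simp add: M.minus_eq)
  then show "x \<ominus>\<^bsub>M\<^esub> y \<in> N"
    using N.a_rcos_self[of "x \<ominus>\<^bsub>M\<^esub> y"] assms by simp
next
  assume "x \<ominus>\<^bsub>M\<^esub> y \<in> N"
  then have "proj (x \<ominus>\<^bsub>M\<^esub> y) = N"
    using assms by (intro M.a_coset_join2) (auto intro: N.a_subgroup)
  then show "proj x = proj y"
    using M.a_coset_add_inv1[OF _ assms N.a_subset] by (simp add: M.minus_eq)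
qed

lemma proj_eq_zero_iff:
  assumes "x \<in> carrier M" shows "proj x = \<zero>\<^bsub>Q\<^esub> \<longleftrightarrow> x \<in> N"
  using assms M.a_coset_join2[OF assms N.a_subgroup] N.a_rcos_self[OF assms] by (auto simp: quot_zero)

lemma proj_add:
  "x \<in> carrier M \<Longrightarrow> y \<in> carrier M \<Longrightarrow> proj x \<oplus>\<^bsub>Q\<^esub> proj y = proj (x \<oplus>\<^bsub>M\<^esub> y)"
  by (simp add: quot_module_def N.a_rcos_sum)

text \<open>The product in \<open>quot_module\<close> is a union over all representatives of the
  coset. As \<open>N\<close> absorbs scalars, all terms of the union are the same coset, and there
  is at least one term.\<close>

lemma proj_smult:
  assumes r: "r \<in> carrier R" and x: "x \<in> carrier M"
  shows "r \<odot>\<^bsub>Q\<^esub> proj x = proj (r \<odot>\<^bsub>M\<^esub> x)"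
proof -
  have *: "proj (r \<odot>\<^bsub>M\<^esub> y) = proj (r \<odot>\<^bsub>M\<^esub> x)" if y: "y \<in> proj x" for y
  proof -
    obtain h where h: "h \<in> N" "y = h \<oplus>\<^bsub>M\<^esub> x"
      using y by (auto simp: a_r_coset_def')
    then have hM: "h \<in> carrier M" using N.a_subset by blast
    have "r \<odot>\<^bsub>M\<^esub> h \<in> N"
      using submodule.smult_closed[OF submodule_N r h(1)] .
    moreover have "r \<odot>\<^bsub>M\<^esub> y \<ominus>\<^bsub>M\<^esub> r \<odot>\<^bsub>M\<^esub> x = r \<odot>\<^bsub>M\<^esub> h"
      using r x hM by (simp add: h(2) smult_r_distr M.minus_eq M.a_assoc M.r_neg)
    ultimately show ?thesis
      using r x hM h by (simp add: proj_eq_iff)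
  qed
  have "(\<Union>y\<in>proj x. proj (r \<odot>\<^bsub>M\<^esub> y)) = (\<Union>y\<in>proj x. proj (r \<odot>\<^bsub>M\<^esub> x))"
    by (rule SUP_cong[OF refl *])
  moreover have "proj x \<noteq> {}"
    using N.a_rcos_self[OF x] by blast
  ultimately show ?thesis
    by (simp add: quot_module_def)
qed

lemma quot_is_module: "Module.module R Q"
proof (rule Module.moduleI)
  show "abelian_group Q"
  proof (rule abelian_groupI)
    fix C assume "C \<in> carrier Q"
    then obtain x where x: "x \<in> carrier M" "C = proj x" by (auto simp: quot_carrier)
    then have "proj (\<ominus>\<^bsub>M\<^esub> x) \<oplus>\<^bsub>Q\<^esub> C = \<zero>\<^bsub>Q\<^esub>"
      by (simp add: proj_add M.l_neg proj_eq_zero_iff)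
    then show "\<exists>D\<in>carrier Q. D \<oplus>\<^bsub>Q\<^esub> C = \<zero>\<^bsub>Q\<^esub>"
      using x by (intro bexI[of _ "proj (\<ominus>\<^bsub>M\<^esub> x)"]) (auto simp: proj_closed)
    have "proj \<zero>\<^bsub>M\<^esub> \<oplus>\<^bsub>Q\<^esub> C = C"
      using x by (simp add: proj_add)
    then show "\<zero>\<^bsub>Q\<^esub> \<oplus>\<^bsub>Q\<^esub> C = C"
      using proj_eq_zero_iff[of "\<zero>\<^bsub>M\<^esub>"] by simp
  next
    show "\<zero>\<^bsub>Q\<^esub> \<in> carrier Q"
      using proj_eq_zero_iff[of "\<zero>\<^bsub>M\<^esub>"] proj_closed[of "\<zero>\<^bsub>M\<^esub>"] by simp
  qed (auto simp: quot_carrier proj_add M.a_ac)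
qed (auto simp: quot_carrier proj_add proj_smult smult_l_distr smult_r_distr smult_assoc1 is_cring)

end

section \<open>Linear maps\<close>

locale linear_map = M: plain_module R M + N: plain_module R N
  for R :: "('a, 'm) ring_scheme" and M :: "('a, 'b) module" and N :: "('a, 'c) module" +
  fixes h assumes lin: "h \<in> lin_maps R M N"
begin

lemma closed: "x \<in> carrier M \<Longrightarrow> h x \<in> carrier N"
  and add: "x \<in> carrier M \<Longrightarrow> y \<in> carrier M \<Longrightarrow> h (x \<oplus>\<^bsub>M\<^esub> y) = h x \<oplus>\<^bsub>N\<^esub> h y"
  and smult: "r \<in> carrier R \<Longrightarrow> x \<in> carrier M \<Longrightarrow> h (r \<odot>\<^bsub>M\<^esub> x) = r \<odot>\<^bsub>N\<^esub> h x"
  using lin by (auto simp: lin_maps_def)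

lemma hom: "abelian_group_hom M N h"
  by (intro abelian_group_homI M.abelian_group_axioms N.abelian_group_axioms group_hom.intro
      group_hom_axioms.intro M.a_group N.a_group) (auto simp: hom_def closed add)

lemma zero: "h \<zero>\<^bsub>M\<^esub> = \<zero>\<^bsub>N\<^esub>"
  by (rule abelian_group_hom.hom_zero[OF hom])

lemma neg: "x \<in> carrier M \<Longrightarrow> h (\<ominus>\<^bsub>M\<^esub> x) = \<ominus>\<^bsub>N\<^esub> h x"
  by (rule abelian_group_hom.hom_a_inv[OF hom])

lemma finsum:
  "f \<in> A \<rightarrow> carrier M \<Longrightarrow> h (finsum M f A) = finsum N (\<lambda>i. h (f i)) A"
proof (induction A rule: infinite_finite_induct)
  case (insert x F)
  then have "f x \<in> carrier M" "f \<in> F \<rightarrow> carrier M" "(\<lambda>i. h (f i)) \<in> F \<rightarrow> carrier N"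
    by (auto intro: closed)
  then show ?case using insert closed by (simp add: add)
qed (auto simp: zero)

lemma minus:
  "x \<in> carrier M \<Longrightarrow> y \<in> carrier M \<Longrightarrow> h (x \<ominus>\<^bsub>M\<^esub> y) = h x \<ominus>\<^bsub>N\<^esub> h y"
  unfolding a_minus_def by (simp add: add neg)

lemma kernel_submodule: "submodule (a_kernel M N h) R M"
  by (rule M.submoduleI) (auto simp: a_kernel_def' add smult zero neg N.smult_r_null)

end

lemma (in quotient_module) quot_plain_module: "plain_module R Q"
  using quot_is_module by (simp add: plain_module_def)

lemma (in quotient_module) proj_linear: "linear_map R M Q proj"
  by (intro linear_map.intro linear_map_axioms.intro quot_plain_module plain_module_axioms)
    (auto simp: lin_maps_def proj_closed proj_add proj_smult)

text \<open>The homomorphism theorem. The map evaluates \<open>\<phi>\<close> at a chosen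
  representative; two representatives differ by an element of \<open>N\<close>, which
  \<open>\<phi>\<close> kills.\<close>

lemma (in quotient_module) lift_linear:
  assumes "linear_map R M N' \<phi>" and ker: "N \<subseteq> a_kernel M N' \<phi>"
  obtains h where "h \<in> lin_maps R Q N'" "\<And>x. x \<in> carrier M \<Longrightarrow> h (proj x) = \<phi> x"
proof
  interpret \<phi>: linear_map R M N' \<phi> by fact
  define h where "h C = \<phi> (SOME x. x \<in> carrier M \<and> proj x = C)" for C
  show *: "h (proj x) = \<phi> x" if x: "x \<in> carrier M" for x
  proof -
    let ?y = "SOME y. y \<in> carrier M \<and> proj y = proj x"
    have y: "?y \<in> carrier M \<and> proj ?y = proj x"
      by (rule someI[of _ x]) (use x in simp)
    then have "?y \<ominus>\<^bsub>M\<^esub> x \<in> N" using x proj_eq_iff by blast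
    then have "\<phi> (?y \<ominus>\<^bsub>M\<^esub> x) = \<zero>\<^bsub>N'\<^esub>" using ker by (auto simp: a_kernel_def')
    then have "\<phi> ?y \<ominus>\<^bsub>N'\<^esub> \<phi> x = \<zero>\<^bsub>N'\<^esub>" using \<phi>.minus x y by metis
    then show ?thesis
      unfolding h_def
      by (rule iffD1[OF \<phi>.N.minus_eq_zero_iff, rotated -1]) (use x y \<phi>.closed in blast)+
  qed
  have "h (proj x \<oplus>\<^bsub>Q\<^esub> proj y) = h (proj x) \<oplus>\<^bsub>N'\<^esub> h (proj y)"
    if "x \<in> carrier M" "y \<in> carrier M" for x y
    using that by (simp add: proj_add * \<phi>.add)
  moreover have "h (r \<odot>\<^bsub>Q\<^esub> proj x) = r \<odot>\<^bsub>N'\<^esub> h (proj x)"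
    if "r \<in> carrier R" "x \<in> carrier M" for r x
    using that by (simp add: proj_smult * \<phi>.smult)
  ultimately show "h \<in> lin_maps R Q N'"
    by (auto simp: lin_maps_def quot_carrier * \<phi>.closed)
qed

lemma (in cring) free_module_plain: "plain_module R (free_module R A)"
  using free_module_is_module by (simp add: plain_module_def)

text \<open>Induction on the finite support: clearing one coordinate of \<open>v\<close> leaves a
  vector of smaller support, and what was removed is a multiple of a basis vector.\<close>

lemma (in cring) free_module_generated:
  assumes N: "submodule N R (free_module R A)" and e: "\<And>a. a \<in> A \<Longrightarrow> basis_vec R a \<in> N"
  shows "carrier (free_module R A) \<subseteq> N"
proof
  interpret F: plain_module R "free_module R A" by (rule free_module_plain)
  fix v assume v: "v \<in> carrier (free_module R A)"
  have "finite {a. v a \<noteq> \<zero>}" using v by (simp add: free_module_carrier)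
  then show "v \<in> N" using v
  proof (induction "{a. v a \<noteq> \<zero>}" arbitrary: v rule: finite_induct)
    case empty
    then have "v = \<zero>\<^bsub>free_module R A\<^esub>" by auto
    then show ?case using F.submodule_zero[OF N] by blast
  next
    case (insert a S)
    define w where "w = v(a := \<zero>)"
    have S: "S = {b. w b \<noteq> \<zero>}" using insert by (auto simp: w_def)
    have a: "a \<in> A" "v a \<in> carrier R"
      using insert free_module_val[OF insert.prems] by (auto simp: free_module_carrier)
    have "w \<in> carrier (free_module R A)"
      using insert.prems insert.hyps(1) unfolding S by (auto simp: free_module_carrier w_def)
    then have "w \<in> N" using insert.hyps(3) S by blast
    moreover have "v a \<odot>\<^bsub>free_module R A\<^esub> basis_vec R a \<in> N"
      using F.submoduleE(4)[OF N a(2)] e[OF a(1)] by blast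
    ultimately have "v a \<odot>\<^bsub>free_module R A\<^esub> basis_vec R a \<oplus>\<^bsub>free_module R A\<^esub> w \<in> N"
      using F.submoduleE(5)[OF N] by blast
    moreover have "v a \<odot>\<^bsub>free_module R A\<^esub> basis_vec R a \<oplus>\<^bsub>free_module R A\<^esub> w = v"
      using a free_module_val[OF insert.prems] by (auto simp: basis_vec_def w_def fun_eq_iff)
    ultimately show ?case by simp
  qed
qed

lemma (in plain_module) free_module_lift:
  assumes g: "g \<in> A \<rightarrow> carrier M"
  defines "\<phi> \<equiv> \<lambda>v. finsum M (\<lambda>a. v a \<odot>\<^bsub>M\<^esub> g a) {a. v a \<noteq> \<zero>\<^bsub>R\<^esub>}"
  shows "linear_map R (free_module R A) M \<phi>"
    and "\<And>a. a \<in> A \<Longrightarrow> \<phi> (basis_vec R a) = g a"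
proof -
  let ?F = "free_module R A"
  have val: "v a \<in> carrier R" "v a \<noteq> \<zero>\<^bsub>R\<^esub> \<Longrightarrow> a \<in> A" if "v \<in> carrier ?F" for v a
    using that R.free_module_val[OF that] by (auto simp: free_module_carrier)
  have fin: "finite {a. v a \<noteq> \<zero>\<^bsub>R\<^esub>}" if "v \<in> carrier ?F" for v
    using that by (simp add: free_module_carrier)
  \<comment> \<open>The support depends on the vector. Any finite index set inside \<open>A\<close>
    that contains it gives the same sum, so \<open>v\<close>, \<open>w\<close> and their sum can
    share one index set.\<close>
  have \<phi>: "\<phi> v = finsum M (\<lambda>a. v a \<odot>\<^bsub>M\<^esub> g a) S"
    if v: "v \<in> carrier ?F" and S: "finite S" "{a. v a \<noteq> \<zero>\<^bsub>R\<^esub>} \<subseteq> S" "S \<subseteq> A" for v S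
    unfolding \<phi>_def
  proof (rule M.add.finprod_mono_neutral_cong_left)
    show "v a \<odot>\<^bsub>M\<^esub> g a = \<zero>\<^bsub>M\<^esub>" if "a \<in> S - {a. v a \<noteq> \<zero>\<^bsub>R\<^esub>}" for a
    proof -
      have "g a \<in> carrier M" "v a = \<zero>\<^bsub>R\<^esub>" using that S g by auto
      then show ?thesis by (simp add: smult_l_null)
    qed
    show "(\<lambda>a. v a \<odot>\<^bsub>M\<^esub> g a) \<in> S \<rightarrow> carrier M"
    proof (rule Pi_I)
      fix a assume "a \<in> S"
      then have "g a \<in> carrier M" using g S(3) by blast
      then show "v a \<odot>\<^bsub>M\<^esub> g a \<in> carrier M" using val(1)[OF v] by simp
    qed
  qed (use S in auto)
  show "linear_map R ?F M \<phi>"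
  proof (intro linear_map.intro linear_map_axioms.intro R.free_module_plain plain_module_axioms)
    have closed: "\<phi> v \<in> carrier M" if v: "v \<in> carrier ?F" for v
      unfolding \<phi>_def using val[OF v] g by (intro M.finsum_closed) auto
    moreover have "\<phi> (v \<oplus>\<^bsub>?F\<^esub> w) = \<phi> v \<oplus>\<^bsub>M\<^esub> \<phi> w"
      if v: "v \<in> carrier ?F" and w: "w \<in> carrier ?F" for v w
    proof -
      interpret F: plain_module R ?F by (rule R.free_module_plain)
      let ?S = "{a. v a \<noteq> \<zero>\<^bsub>R\<^esub>} \<union> {a. w a \<noteq> \<zero>\<^bsub>R\<^esub>}"
      have S: "finite ?S" "?S \<subseteq> A" using fin val v w by auto
      have gS: "g a \<in> carrier M" if "a \<in> ?S" for a using that S g by auto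
      have "\<phi> (v \<oplus>\<^bsub>?F\<^esub> w) = finsum M (\<lambda>a. (v \<oplus>\<^bsub>?F\<^esub> w) a \<odot>\<^bsub>M\<^esub> g a) ?S"
        using F.M.a_closed[OF v w] S by (intro \<phi>) auto
      also have "\<dots> = finsum M (\<lambda>a. v a \<odot>\<^bsub>M\<^esub> g a \<oplus>\<^bsub>M\<^esub> w a \<odot>\<^bsub>M\<^esub> g a) ?S"
        by (rule M.finsum_cong') (use val[OF v] val[OF w] gS in \<open>auto simp: smult_l_distr\<close>)
      also have "\<dots> = finsum M (\<lambda>a. v a \<odot>\<^bsub>M\<^esub> g a) ?S \<oplus>\<^bsub>M\<^esub> finsum M (\<lambda>a. w a \<odot>\<^bsub>M\<^esub> g a) ?S"
        by (rule M.finsum_addf) (use val[OF v] val[OF w] gS in auto)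
      also have "\<dots> = \<phi> v \<oplus>\<^bsub>M\<^esub> \<phi> w"
        using \<phi>[OF v S(1) _ S(2)] \<phi>[OF w S(1) _ S(2)] by simp
      finally show ?thesis .
    qed
    moreover have "\<phi> (r \<odot>\<^bsub>?F\<^esub> v) = r \<odot>\<^bsub>M\<^esub> \<phi> v"
      if r: "r \<in> carrier R" and v: "v \<in> carrier ?F" for r v
    proof -
      interpret F: plain_module R ?F by (rule R.free_module_plain)
      let ?S = "{a. v a \<noteq> \<zero>\<^bsub>R\<^esub>}"
      have S: "finite ?S" "?S \<subseteq> A" using fin val v by auto
      have gS: "g a \<in> carrier M" if "a \<in> ?S" for a using that S g by auto
      have "\<phi> (r \<odot>\<^bsub>?F\<^esub> v) = finsum M (\<lambda>a. (r \<odot>\<^bsub>?F\<^esub> v) a \<odot>\<^bsub>M\<^esub> g a) ?S"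
        using F.smult_closed[OF r v] S r by (intro \<phi>) auto
      also have "\<dots> = finsum M (\<lambda>a. r \<odot>\<^bsub>M\<^esub> (v a \<odot>\<^bsub>M\<^esub> g a)) ?S"
        by (rule M.finsum_cong') (use val[OF v] r gS in \<open>auto simp: smult_assoc1\<close>)
      also have "\<dots> = r \<odot>\<^bsub>M\<^esub> \<phi> v"
        unfolding \<phi>_def using S r val[OF v] gS by (intro finsum_smult_ldistr[symmetric]) auto
      finally show ?thesis .
    qed
    ultimately show "\<phi> \<in> lin_maps R ?F M" by (auto simp: lin_maps_def)
  qed
  fix a assume a: "a \<in> A"
  have ga: "g a \<in> carrier M" using a g by blast
  have "\<phi> (basis_vec R a) = finsum M (\<lambda>b. basis_vec R a b \<odot>\<^bsub>M\<^esub> g b) {a}"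
    using a by (intro \<phi> R.basis_vec_carrier) (auto simp: basis_vec_def)
  also have "\<dots> = g a"
    using ga by (subst M.add.finprod_insert[of "{}", simplified]) (auto simp: basis_vec_def)
  finally show "\<phi> (basis_vec R a) = g a" .
qed

section \<open>Polynomials\<close>

abbreviation (input) keys where "keys \<equiv> Poly_Mapping.keys"
abbreviation (input) lookup where "lookup \<equiv> Poly_Mapping.lookup"
abbreviation (input) single where "single \<equiv> Poly_Mapping.single"

text \<open>A polynomial is the sum of its terms, and the partial sums never leave
  \<open>polys_in V\<close>. The monomial case admits \<open>c = 0\<close> and so covers the zero
  polynomial.\<close>

lemma mpoly_induct [consumes 1, case_names monom add]:
  assumes "f \<in> polys_in V"
    and "\<And>m c. keys m \<subseteq> V \<Longrightarrow> P (single m c)"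
    and "\<And>f g. f \<in> polys_in V \<Longrightarrow> g \<in> polys_in V \<Longrightarrow> P f \<Longrightarrow> P g \<Longrightarrow> P (f + g)"
  shows "P f"
proof -
  have *: "P (\<Sum>m\<in>A. single m (lookup f m)) \<and> (\<Sum>m\<in>A. single m (lookup f m)) \<in> polys_in V"
    if "finite A" "A \<subseteq> keys f" for A
    using that
  proof (induction A)
    case empty
    show ?case using assms(2)[of 0 0] by (simp add: polys_in_def)
  next
    case (insert m A)
    then have m: "single m (lookup f m) \<in> polys_in V" "P (single m (lookup f m))"
      using assms(1,2) by (auto simp: polys_in_def)
    then have "single m (lookup f m) + (\<Sum>m\<in>A. single m (lookup f m)) \<in> polys_in V"
      using insert keys_add[of "single m (lookup f m)" "\<Sum>m\<in>A. single m (lookup f m)"]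
      by (fastforce simp: polys_in_def)
    then show ?case
      using m insert by (auto intro: assms(3))
  qed
  have "f = (\<Sum>m\<in>keys f. single m (lookup f m))"
    by (rule poly_mapping_eqI) (simp add: lookup_sum lookup_single when_def in_keys_iff)
  then show ?thesis using *[of "keys f"] by simp
qed

text \<open>Opens \<open>mpoly_induct\<close> to polynomials without a bound on their
  variables.\<close>

lemma polys_in_UNIV: "f \<in> polys_in UNIV"
  by (simp add: polys_in_def)

lemma keys_nat_add: "keys (m + m' :: 'a \<Rightarrow>\<^sub>0 nat) = keys m \<union> keys m'"
  by (auto simp: in_keys_iff lookup_add)

lemma polys_in_zero: "0 \<in> polys_in V"
  and polys_in_single: "keys m \<subseteq> V \<Longrightarrow> single m c \<in> polys_in V"
  and polys_in_add: "f \<in> polys_in V \<Longrightarrow> g \<in> polys_in V \<Longrightarrow> f + g \<in> polys_in V"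
  and polys_in_uminus: "f \<in> polys_in V \<Longrightarrow> - f \<in> polys_in V"
  and polys_in_mult: "f \<in> polys_in V \<Longrightarrow> g \<in> polys_in V \<Longrightarrow> f * g \<in> polys_in V"
  and polys_in_mono: "V \<subseteq> W \<Longrightarrow> f \<in> polys_in V \<Longrightarrow> f \<in> polys_in W"
  subgoal by (simp add: polys_in_def)
  subgoal by (auto simp: polys_in_def)
  subgoal using keys_add[of f g] by (fastforce simp: polys_in_def)
  subgoal by (auto simp: polys_in_def in_keys_iff)
  subgoal using keys_mult[of f g] by (fastforce simp: polys_in_def keys_nat_add)
  subgoal by (auto simp: polys_in_def)
  done

lemma polys_in_diff: "f \<in> polys_in V \<Longrightarrow> g \<in> polys_in V \<Longrightarrow> f - g \<in> polys_in V"
  using polys_in_add[OF _ polys_in_uminus, of f V g] by simp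

lemma polys_in_one: "1 \<in> polys_in V"
  using polys_in_single[of 0 V 1] by simp

lemma polys_in_const: "const c \<in> polys_in V"
  by (simp add: const_def polys_in_single)

lemma polys_in_X: "i \<in> V \<Longrightarrow> X i \<in> polys_in V"
  by (simp add: X_def polys_in_single)

lemma polys_in_sum: "(\<And>i. i \<in> A \<Longrightarrow> f i \<in> polys_in V) \<Longrightarrow> sum f A \<in> polys_in V"
  by (induction A rule: infinite_finite_induct) (auto simp: polys_in_zero polys_in_add)

section \<open>\<open>PR n\<close> as a commutative ring\<close>

lemma PR_sel [simp]:
  "f \<oplus>\<^bsub>PR n\<^esub> g = f + g" "f \<otimes>\<^bsub>PR n\<^esub> g = f * g" "\<zero>\<^bsub>PR n\<^esub> = 0" "\<one>\<^bsub>PR n\<^esub> = 1"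
  by (simp_all add: PR_def)

lemma PR_carrier: "carrier (PR n) = polys_in {0..n}"
  by (simp add: PR_def)

lemma PR_cring: "cring (PR n :: 'k::field mpoly ring)"
proof (rule cringI)
  show "abelian_group (PR n :: 'k mpoly ring)"
  proof (rule abelian_groupI)
    fix f :: "'k mpoly" assume "f \<in> carrier (PR n)"
    then show "\<exists>g\<in>carrier (PR n). g \<oplus>\<^bsub>PR n\<^esub> f = \<zero>\<^bsub>PR n\<^esub>"
      by (intro bexI[of _ "- f"]) (auto simp: PR_carrier polys_in_uminus)
  qed (auto simp: PR_carrier polys_in_add polys_in_zero add.assoc add.commute)
  show "comm_monoid (PR n :: 'k mpoly ring)"
    by (rule comm_monoidI) (auto simp: PR_carrier polys_in_mult polys_in_one ac_simps)
qed (simp add: distrib_right)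

lemma PR_uminus: "f \<in> carrier (PR n) \<Longrightarrow> \<ominus>\<^bsub>PR n\<^esub> f = - f"
proof -
  interpret cring "PR n :: 'k::field mpoly ring" by (rule PR_cring)
  assume "f \<in> carrier (PR n)"
  then show ?thesis
    by (intro minus_equality) (auto simp: PR_carrier polys_in_uminus)
qed

lemma lookup_single_times:
  fixes f :: "'k::field mpoly"
  shows "lookup (single a c * f) (a + m) = c * lookup f m"
  using polys_in_UNIV[of f]
  by (induction f rule: mpoly_induct)
    (auto simp: mult_single lookup_single when_def lookup_add distrib_left)

lemma lookup_const_times: "lookup (const c * f) m = c * lookup f m"
  using lookup_single_times[of 0 c f m] by (simp add: const_def)

subsection \<open>The triangular decomposition\<close>

text \<open>Each nonconstant term of \<open>F\<close> belongs to the component of its least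
  variable: the terms \<open>m X\<^sub>i\<close> with \<open>m\<close> free of variables before
  \<open>X\<^sub>i\<close> are those whose least variable is \<open>X\<^sub>i\<close>. This
  coefficient formula for the entries of \<open>theta\<close> is total and visibly additive, which a
  definite description is not.\<close>

lift_definition tri :: "nat \<Rightarrow> 'k::field mpoly \<Rightarrow> 'k mpoly" is
  "\<lambda>i F m. if keys m \<subseteq> {i..} then F (m + single i 1) else 0"
proof -
  fix i and F :: "(nat \<Rightarrow>\<^sub>0 nat) \<Rightarrow> 'k" assume "finite {m. F m \<noteq> 0}"
  then have "finite ((\<lambda>m. m + single i 1) -` {m. F m \<noteq> 0})"
    by (intro finite_vimageI) (auto simp: inj_on_def)
  then show "finite {m. (if keys m \<subseteq> {i..} then F (m + single i 1) else 0) \<noteq> 0}"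
    by (rule rev_finite_subset) auto
qed

lemma tri_zero [simp]: "tri i 0 = 0"
  by (rule poly_mapping_eqI) (simp add: tri.rep_eq)

lemma tri_add: "tri i (F + G) = tri i F + tri i G"
  by (rule poly_mapping_eqI) (simp add: tri.rep_eq lookup_add)

lemma tri_sum: "tri i (sum F A) = (\<Sum>a\<in>A. tri i (F a))"
  by (induction A rule: infinite_finite_induct) (auto simp: tri_add)

text \<open>The uniqueness half of the triangular decomposition: every term of
  \<open>f * X i\<close> has least variable \<open>X i\<close>, so all of it lands in component
  \<open>i\<close>.\<close>

lemma tri_mult_X:
  fixes f :: "'k::field mpoly"
  assumes "f \<in> polys_in {i..}"
  shows "tri j (f * X i) = (if j = i then f else 0)"
  using assms
proof (induction f rule: mpoly_induct)
  case (monom m c)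
  have "lookup (tri j (single m c * X i)) k = lookup (if j = i then single m c else 0) k" for k
  proof (cases "m + single i 1 = k + single j 1")
    case True
    then have "i \<in> keys (k + single j 1)" "j \<in> keys (m + single i 1)"
      by (metis UnCI keys_nat_add keys_single singletonI zero_neq_one)+
    \<comment> \<open>Both \<open>i\<close> and \<open>j\<close> are the least variable of the same
      monomial.\<close>
    then have "i = j" if "keys k \<subseteq> {j..}"
      using that monom by (fastforce simp: keys_nat_add)
    then show ?thesis
      using True monom
      by (auto simp: tri.rep_eq X_def mult_single lookup_single when_def)
  next
    case False
    then show ?thesis
      by (auto simp: tri.rep_eq X_def mult_single lookup_single when_def)
  qed
  then show ?case by (rule poly_mapping_eqI)
qed (auto simp: tri_add distrib_right)

lemma tri_in_polys:
  assumes "F \<in> polys_in {0..n}" shows "tri i F \<in> polys_in {i..n}"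
proof -
  have "keys m \<subseteq> {i..n}" if "m \<in> keys (tri i F)" for m
  proof -
    have m: "keys m \<subseteq> {i..}" "m + single i 1 \<in> keys F"
      using that by (auto simp: in_keys_iff tri.rep_eq split: if_splits)
    then have "keys m \<subseteq> {0..n}"
      using assms by (force simp: polys_in_def keys_nat_add)
    moreover have "{0..n} \<inter> {i..} = {i..n}" by auto
    ultimately show ?thesis using m(1) by (metis Int_greatest)
  qed
  then show ?thesis by (simp add: polys_in_def)
qed

text \<open>Elements of \<open>free_module\<close> must vanish off the index set. A nonzero
  component \<open>i\<close> would force \<open>X i\<close> to occur in \<open>F\<close>.\<close>

lemma tri_beyond:
  assumes "F \<in> polys_in {0..n}" "i > n" shows "tri i F = 0"
proof (rule poly_mapping_eqI)
  fix m :: "nat \<Rightarrow>\<^sub>0 nat"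
  have "i \<in> keys (m + single i 1)" by (simp add: keys_nat_add)
  then have "m + single i 1 \<notin> keys F" using assms by (force simp: polys_in_def)
  then show "lookup (tri i F) m = lookup 0 m" by (simp add: tri.rep_eq in_keys_iff)
qed

text \<open>The least variable is split off, so the cofactor meets the triangularity condition. The
  last conclusion keeps the cofactor within the variables of the given monomial.\<close>

lemma monomial_split:
  assumes "m \<noteq> (0 :: nat \<Rightarrow>\<^sub>0 nat)"
  obtains i k where "m = k + single i 1" "i \<in> keys m" "keys k \<subseteq> {i..}" "keys k \<subseteq> keys m"
proof
  have ne: "keys m \<noteq> {}" using assms by simp
  let ?i = "Min (keys m)" let ?k = "m - single ?i 1"
  show i: "?i \<in> keys m" using ne by simp
  then show "m = ?k + single ?i 1"
    by (intro poly_mapping_eqI) (auto simp: lookup_add lookup_minus lookup_single when_def in_keys_iff)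
  show km: "keys ?k \<subseteq> keys m"
    by (auto simp: in_keys_iff lookup_minus)
  then show "keys ?k \<subseteq> {?i..}"
    by auto
qed

text \<open>The constant term is split off so that the induction can run over arbitrary terms,
  including constants.\<close>

lemma tri_decomposition:
  fixes F :: "'k::field mpoly"
  assumes "F \<in> polys_in {0..n}"
  shows "F = const (lookup F 0) + (\<Sum>i=0..n. tri i F * X i)"
  using assms
proof (induction F rule: mpoly_induct)
  case (monom m c)
  show ?case
  proof (cases "m = 0")
    case True
    have "m + single i 1 \<noteq> 0" for m :: "nat \<Rightarrow>\<^sub>0 nat" and i
      by (metis UnCI empty_iff keys_nat_add keys_single keys_zero singletonI zero_neq_one)
    then have "tri i (single 0 c) = 0" for i
      by (intro poly_mapping_eqI) (simp add: tri.rep_eq lookup_single when_def)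
    then show ?thesis using True by (simp add: const_def)
  next
    case False
    then obtain i k where ik: "m = k + single i 1" "i \<in> keys m" "keys k \<subseteq> {i..}"
      by (rule monomial_split)
    have eq: "single m c = single k c * X i"
      by (simp add: ik(1) X_def mult_single)
    have "single k c \<in> polys_in {i..}" using ik by (simp add: polys_in_single)
    then have "tri j (single m c) * X j = (if j = i then single m c else 0)" for j
      unfolding eq by (simp add: tri_mult_X)
    moreover have "i \<in> {0..n}" using ik monom by auto
    ultimately show ?thesis
      using False by (simp add: const_def lookup_single)
  qed
next
  case (add f g)
  let ?S = "\<lambda>F. const (lookup F 0) + (\<Sum>i=0..n. tri i F * X i)"
  have "f + g = ?S f + ?S g" using add by simp
  also have "\<dots> = ?S (f + g)"
    by (simp add: tri_add distrib_right sum.distrib lookup_add const_def single_add)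
  finally show ?case .
qed

section \<open>The irrelevant ideal and the entries of \<open>theta\<close>\<close>

lemma lookup_mult_zero:
  fixes f g :: "'k::field mpoly"
  assumes "lookup g 0 = 0" shows "lookup (f * g) 0 = 0"
proof -
  have "0 \<notin> keys (f * g)"
  proof
    assume "0 \<in> keys (f * g)"
    then obtain a b where ab: "0 = a + b" "b \<in> keys g" using keys_mult by blast
    then have "keys b = {}" by (metis Un_empty keys_nat_add keys_zero)
    then show False using ab assms by (simp add: in_keys_iff)
  qed
  then show ?thesis by (simp add: in_keys_iff)
qed

lemma lookup_X_zero [simp]: "lookup (X i) 0 = 0"
  by (auto simp: X_def lookup_single when_def dest: arg_cong[of _ _ keys])

text \<open>The triangular decomposition itself exhibits a polynomial without constant term as a
  combination of the variables. Membership thereby becomes a test on one coefficient.\<close>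

lemma irrelevant_eq:
  "irrelevant n = {F :: 'k::field mpoly. F \<in> polys_in {0..n} \<and> lookup F 0 = 0}" (is "_ = ?N")
proof
  interpret P: cring "PR n :: 'k mpoly ring" by (rule PR_cring)
  have X: "X ` {0..n} \<subseteq> carrier (PR n :: 'k mpoly ring)"
    by (auto simp: PR_carrier polys_in_X)
  have "ideal ?N (PR n)"
  proof (rule idealI[OF P.ring_axioms])
    show "subgroup ?N (add_monoid (PR n))"
      by (rule P.add.subgroupI)
        (auto simp: PR_carrier polys_in_add lookup_add polys_in_uminus
          PR_uminus[unfolded PR_carrier] intro: polys_in_zero)
  next
    fix f g :: "'k mpoly" assume "f \<in> ?N" "g \<in> carrier (PR n)"
    then show "g \<otimes>\<^bsub>PR n\<^esub> f \<in> ?N" "f \<otimes>\<^bsub>PR n\<^esub> g \<in> ?N"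
      by (auto simp: PR_carrier polys_in_mult lookup_mult_zero mult.commute[of f])
  qed
  then show "irrelevant n \<subseteq> ?N"
    unfolding irrelevant_def by (rule P.genideal_minimal) (auto simp: polys_in_X)
  show "?N \<subseteq> irrelevant n"
  proof
    fix F :: "'k mpoly" assume F: "F \<in> ?N"
    interpret M: ideal "irrelevant n :: 'k mpoly set" "PR n"
      unfolding irrelevant_def by (rule P.genideal_ideal[OF X])
    have "(\<Sum>i\<in>A. tri i F * X i) \<in> irrelevant n" if "A \<subseteq> {0..n}" for A
      using that
    proof (induction A rule: infinite_finite_induct)
      case (insert i A)
      have "tri i F \<in> polys_in {i..n}" using F by (auto intro: tri_in_polys)
      then have "tri i F \<in> carrier (PR n)"
        unfolding PR_carrier by (rule polys_in_mono[rotated]) auto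
      moreover have "(X i :: 'k mpoly) \<in> irrelevant n"
        unfolding irrelevant_def using insert.prems by (intro subsetD[OF P.genideal_self[OF X]]) simp
      ultimately have "tri i F \<otimes>\<^bsub>PR n\<^esub> X i \<in> irrelevant n"
        by (rule M.I_l_closed[rotated])
      then show ?case using insert M.a_closed[of "tri i F * X i"] by simp
    qed (use M.zero_closed in simp_all)
    then have "(\<Sum>i=0..n. tri i F * X i) \<in> irrelevant n" by simp
    moreover have "F = (\<Sum>i=0..n. tri i F * X i)"
      using tri_decomposition[of F n] F by (simp add: const_def)
    ultimately show "F \<in> irrelevant n" by simp
  qed
qed

text \<open>Existence is \<open>tri_decomposition\<close>. For uniqueness, \<open>tri j\<close>
  applied to any triangular decomposition of \<open>F\<close> returns its entry
  \<open>j\<close>.\<close>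

lemma theta_eq:
  fixes F :: "'k::field mpoly"
  assumes "F \<in> irrelevant n"
  shows "theta n F = (\<lambda>i. tri i F)"
  unfolding theta_def
proof (rule the_equality)
  have F: "F \<in> polys_in {0..n}" "lookup F 0 = 0" using assms by (auto simp: irrelevant_eq)
  have "tri i F \<in> polys_in {0..n}" for i
    using tri_in_polys[OF F(1)] by (rule polys_in_mono[rotated]) auto
  moreover have "{i. tri i F \<noteq> 0} \<subseteq> {0..n}"
    using tri_beyond[OF F(1)] by (metis (mono_tags, lifting) atLeastAtMost_iff le0 linorder_not_le mem_Collect_eq subsetI)
  ultimately show "(\<lambda>i. tri i F) \<in> carrier (free_module (PR n) {0..n}) \<and>
    (\<forall>i\<in>{0..n}. tri i F \<in> polys_in {i..n}) \<and> F = (\<Sum>i = 0..n. tri i F * X i)"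
    using F tri_beyond[OF F(1)] tri_in_polys[OF F(1)] tri_decomposition[OF F(1)]
    by (auto simp: free_module_carrier PR_carrier const_def intro: finite_subset)
next
  fix v assume v: "v \<in> carrier (free_module (PR n) {0..n}) \<and>
    (\<forall>i\<in>{0..n}. v i \<in> polys_in {i..n}) \<and> F = (\<Sum>i = 0..n. v i * X i)"
  have "v j = tri j F" for j
  proof -
    have "tri j F = (\<Sum>i = 0..n. tri j (v i * X i))"
      using v by (simp add: tri_sum)
    also have "\<dots> = (\<Sum>i = 0..n. if j = i then v i else 0)"
    proof (rule sum.cong[OF refl])
      fix i assume "i \<in> {0..n}"
      then have "v i \<in> polys_in {i..}"
        using v by (auto intro: polys_in_mono[of "{i..n}"])
      then show "tri j (v i * X i) = (if j = i then v i else 0)"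
        by (rule tri_mult_X)
    qed
    also have "\<dots> = v j"
      using v by (auto simp: free_module_carrier)
    finally show ?thesis by simp
  qed
  then show "v = (\<lambda>i. tri i F)" by blast
qed

subsection \<open>Homogeneous polynomials and the Euler operator\<close>

lemma mdeg_superset: "finite A \<Longrightarrow> keys m \<subseteq> A \<Longrightarrow> mdeg m = (\<Sum>i\<in>A. lookup m i)"
  unfolding mdeg_def by (rule sum.mono_neutral_left) (auto simp: in_keys_iff)

lemma mdeg_add: "mdeg (m + k) = mdeg m + mdeg k"
  using mdeg_superset[of "keys m \<union> keys k"]
  by (simp add: keys_nat_add lookup_add sum.distrib)

lemma mdeg_single [simp]: "mdeg (single i d) = d"
  by (simp add: mdeg_def)

lemma mdeg_zero [simp]: "mdeg 0 = 0"
  by (simp add: mdeg_def)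

lemma mdeg_eq_zero_iff: "mdeg m = 0 \<longleftrightarrow> m = 0"
proof
  assume "mdeg m = 0"
  then have "lookup m i = 0" for i
    by (cases "i \<in> keys m") (auto simp: mdeg_def in_keys_iff)
  then show "m = 0" by (intro poly_mapping_eqI) simp
qed simp

lemma homogeneous_zero: "homogeneous d 0"
  by (simp add: homogeneous_def)

lemma homogeneous_add: "homogeneous d f \<Longrightarrow> homogeneous d g \<Longrightarrow> homogeneous d (f + g)"
  using keys_add[of f g] by (auto simp: homogeneous_def)

lemma homogeneous_diff: "homogeneous d f \<Longrightarrow> homogeneous d g \<Longrightarrow> homogeneous d (f - g)"
  using keys_diff[of f g] by (auto simp: homogeneous_def)

lemma homogeneous_sum: "(\<And>i. i \<in> A \<Longrightarrow> homogeneous d (f i)) \<Longrightarrow> homogeneous d (sum f A)"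
  by (induction A rule: infinite_finite_induct) (auto simp: homogeneous_zero homogeneous_add)

lemma homogeneous_mult: "homogeneous d f \<Longrightarrow> homogeneous e g \<Longrightarrow> homogeneous (d + e) (f * g)"
  using keys_mult[of f g] by (fastforce simp: homogeneous_def mdeg_add)

lemma homogeneous_single: "homogeneous (mdeg m) (single m c)"
  by (simp add: homogeneous_def)

lemma homogeneous_X: "homogeneous 1 (X i)"
  by (simp add: homogeneous_def X_def)

lemma lookup_hom_comp: "lookup (hom_comp d f) m = (if mdeg m = d then lookup f m else 0)"
  unfolding hom_comp_def by (auto simp: lookup_sum lookup_single when_def in_keys_iff)

text \<open>The Euler derivation, the sum of \<open>X\<^sub>i\<close> times the partial derivative
  in \<open>X\<^sub>i\<close>.\<close>

definition euler_op :: "'k::field mpoly \<Rightarrow> 'k mpoly" where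
  "euler_op = Poly_Mapping.mapp (\<lambda>m c. of_nat (mdeg m) * c)"

lemma lookup_euler_op: "lookup (euler_op f) m = of_nat (mdeg m) * lookup f m"
  by (simp add: euler_op_def lookup_mapp when_def in_keys_iff)

lemma euler_op_add: "euler_op (f + g) = euler_op f + euler_op g"
  by (rule poly_mapping_eqI) (simp add: lookup_euler_op lookup_add distrib_left)

lemma euler_op_single: "euler_op (single m c) = single m (of_nat (mdeg m) * c)"
  by (rule poly_mapping_eqI) (simp add: lookup_euler_op lookup_single when_def)

lemma euler_op_mult: "euler_op (f * g) = f * euler_op g + g * euler_op f"
  using polys_in_UNIV[of f]
proof (induction f rule: mpoly_induct)
  case (monom m c)
  show ?case using polys_in_UNIV[of g]
  proof (induction g rule: mpoly_induct)
    case (monom k d)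
    have "of_nat (mdeg (m + k)) * (c * d) = c * (of_nat (mdeg k) * d) + d * (of_nat (mdeg m) * c)"
      by (simp add: mdeg_add algebra_simps)
    then show ?case
      by (simp add: euler_op_single mult_single single_add[symmetric] add.commute[of k m])
  qed (simp add: euler_op_add distrib_left distrib_right)
qed (simp add: euler_op_add distrib_left distrib_right)

lemma euler_op_const: "euler_op (const c) = 0"
  by (simp add: const_def euler_op_single)

lemma euler_op_X: "euler_op (X i) = X i"
  by (simp add: X_def euler_op_single)

lemma euler_op_polys_in: "f \<in> polys_in V \<Longrightarrow> euler_op f \<in> polys_in V"
  by (auto simp: polys_in_def in_keys_iff lookup_euler_op)

text \<open>Writes the derivative as a combination of homogeneous components, so that homogeneous
  ideals are seen to be stable under it.\<close>

lemma euler_op_hom_comp: "euler_op f = (\<Sum>d\<in>mdeg ` keys f. const (of_nat d) * hom_comp d f)"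
proof (rule poly_mapping_eqI)
  fix m
  have "lookup (\<Sum>d\<in>mdeg ` keys f. const (of_nat d) * hom_comp d f) m
      = (\<Sum>d\<in>mdeg ` keys f. if mdeg m = d then of_nat (mdeg m) * lookup f m else 0)"
    unfolding lookup_sum lookup_const_times lookup_hom_comp by (rule sum.cong) auto
  also have "\<dots> = of_nat (mdeg m) * lookup f m"
    by (cases "m \<in> keys f") (auto simp: in_keys_iff)
  finally show "lookup (euler_op f) m = lookup (\<Sum>d\<in>mdeg ` keys f. const (of_nat d) * hom_comp d f) m"
    by (simp add: lookup_euler_op)
qed

subsection \<open>Degrees of minimal generators\<close>

text \<open>\<open>P x\<close> says that no later value lies below \<open>s x\<close>. Beyond every
  index there is such a point, namely a minimiser of \<open>s\<close> on the tail, and these points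
  form the subsequence.\<close>

lemma nat_mono_subseq:
  fixes s :: "nat \<Rightarrow> nat"
  obtains f :: "nat \<Rightarrow> nat" where "strict_mono f" "\<And>i j. i \<le> j \<Longrightarrow> s (f i) \<le> s (f j)"
proof -
  define P where "P x \<longleftrightarrow> (\<forall>y\<ge>x. s x \<le> s y)" for x
  have ex: "\<exists>y>x. P y" for x
  proof -
    let ?y = "arg_min s (\<lambda>y. y > x)"
    have "?y > x" "s ?y \<le> s y" if "y > x" for y
      using arg_min_natI[of "\<lambda>y. y > x" "Suc x" s] arg_min_nat_le[of "\<lambda>y. y > x" y s] that by auto
    then have "?y > x \<and> P ?y" unfolding P_def by (meson lessI less_le_trans)
    then show ?thesis by blast
  qed
  have "\<exists>f. \<forall>n. P (f n) \<and> f n < f (Suc n)"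
    by (rule dependent_nat_choice) (use ex in auto)
  then obtain f where f: "\<And>n. P (f n)" "\<And>n. f n < f (Suc n)" by blast
  show thesis
  proof (rule that)
    show sm: "strict_mono f" using f(2) by (simp add: strict_mono_Suc_iff)
    show "s (f i) \<le> s (f j)" if "i \<le> j" for i j
      using f(1)[of i] that by (simp add: P_def strict_mono_less_eq[OF sm])
  qed
qed

text \<open>Dickson's lemma for sequences of exponent vectors. Coordinates are treated one at a
  time; a further subsequence keeps the monotonicity already gained.\<close>

lemma dickson:
  fixes s :: "nat \<Rightarrow> 'a \<Rightarrow> nat"
  assumes "finite V"
  shows "\<exists>f :: nat \<Rightarrow> nat. strict_mono f \<and> (\<forall>v\<in>V. \<forall>i j. i \<le> j \<longrightarrow> s (f i) v \<le> s (f j) v)"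
  using assms
proof induction
  case empty
  show ?case by (intro exI[of _ id]) (auto simp: strict_mono_def)
next
  case (insert v V)
  then obtain f :: "nat \<Rightarrow> nat" where f: "strict_mono f" "\<And>v i j. v \<in> V \<Longrightarrow> i \<le> j \<Longrightarrow> s (f i) v \<le> s (f j) v"
    by blast
  obtain g :: "nat \<Rightarrow> nat" where g: "strict_mono g" "\<And>i j. i \<le> j \<Longrightarrow> s (f (g i)) v \<le> s (f (g j)) v"
    using nat_mono_subseq[of "\<lambda>i. s (f i) v"] by blast
  have "strict_mono (f \<circ> g)" using f(1) g(1) by (rule strict_mono_o)
  then show ?case
    using f(2) g strict_mono_less_eq[OF g(1)] by (intro exI[of _ "f \<circ> g"]) (auto simp: o_def)
qed

text \<open>No exponent exceeds the degree, so the exponent vectors are among the functions from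
  \<open>V\<close> to \<open>{..d}\<close>. This provides a least leading monomial in each
  degree.\<close>

lemma finite_monomials:
  assumes "finite V" shows "finite {m. keys m \<subseteq> V \<and> mdeg m = d}"
proof (rule finite_imageD)
  have "lookup m i \<le> mdeg m" for m i
    by (cases "i \<in> keys m") (auto simp: mdeg_def in_keys_iff intro: member_le_sum)
  then have "lookup ` {m. keys m \<subseteq> V \<and> mdeg m = d}
    \<subseteq> {f. \<forall>i. (i \<in> V \<longrightarrow> f i \<in> {..d}) \<and> (i \<notin> V \<longrightarrow> f i = 0)}"
    by (auto simp: in_keys_iff)
  then show "finite (lookup ` {m. keys m \<subseteq> V \<and> mdeg m = d})"
    by (rule finite_subset) (rule finite_set_of_finite_funs, use assms in auto)
qed (auto simp: inj_on_def poly_mapping_eqI)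

text \<open>The order on exponents is total and compatible with addition, so multiplying
  \<open>f\<close> by a term shifts its leading monomial. The coefficient is the quotient that makes
  both leading terms cancel.\<close>

lemma leading_monomial_cancel:
  fixes f g :: "'k::field mpoly"
  assumes f: "f \<noteq> 0" and g: "g \<noteq> 0" and Mg: "Max (keys g) = a + Max (keys f)"
  defines "h \<equiv> g - single a (lookup g (Max (keys g)) / lookup f (Max (keys f))) * f"
  assumes h: "h \<noteq> 0"
  shows "Max (keys h) < Max (keys g)"
proof -
  let ?c = "lookup g (Max (keys g)) / lookup f (Max (keys f))"
  have "Max (keys f) \<in> keys f" using f by simp
  then have "lookup h (Max (keys g)) = 0"
    unfolding h_def Mg lookup_minus lookup_single_times by (simp add: in_keys_iff)
  then have "k \<noteq> Max (keys g)" if "k \<in> keys h" for k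
    using that by (auto simp: in_keys_iff)
  moreover have "k \<le> Max (keys g)" if k: "k \<in> keys h" for k
  proof -
    consider "k \<in> keys g" | "k \<in> keys (single a ?c * f)"
      using k keys_diff[of g "single a ?c * f"] unfolding h_def by blast
    then show ?thesis
    proof cases
      case 2
      then obtain k' where "k = a + k'" "k' \<in> keys f"
        using keys_mult[of "single a ?c" f] by (auto split: if_splits)
      then show ?thesis unfolding Mg by (simp add: add_left_mono)
    qed simp
  qed
  ultimately show ?thesis
    using h by (auto simp: less_le)
qed

text \<open>A homogeneous element of \<open>I - \<MM>I\<close> whose leading monomial is minimal in its degree cannot be
  reduced by such an element of lower degree; by Dickson's lemma only finitely many degrees occur.\<close>

lemma finite_min_gen_degrees:
  fixes I :: "'k::field mpoly set"
  assumes I: "ideal I (PR n)"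
  defines "J \<equiv> ideal_prod (PR n) (irrelevant n) I"
  shows "finite {d. \<exists>f\<in>I. homogeneous d f \<and> f \<notin> J}" (is "finite ?D")
proof (rule ccontr)
  interpret P: cring "PR n :: 'k mpoly ring" by (rule PR_cring)
  interpret I: ideal I "PR n" by (rule I)
  have M: "ideal (irrelevant n :: 'k mpoly set) (PR n)"
    unfolding irrelevant_def by (rule P.genideal_ideal) (auto simp: PR_carrier polys_in_X)
  interpret J: ideal J "PR n"
    unfolding J_def by (rule P.ideal_prod_is_ideal[OF M I])
  define B where "B d = {m. \<exists>f\<in>I. homogeneous d f \<and> f \<notin> J \<and> m = Max (keys f)}" for d
  have nz: "f \<noteq> 0" if "f \<notin> J" for f
    using that J.zero_closed by auto
  have IP: "keys m \<subseteq> {0..n}" if "f \<in> I" "m \<in> keys f" for f m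
    using that I.a_subset by (auto simp: PR_carrier polys_in_def)
  have B: "keys m \<subseteq> {0..n}" "mdeg m = d" if m: "m \<in> B d" for m d
  proof -
    obtain f where f: "f \<in> I" "homogeneous d f" "f \<notin> J" "m = Max (keys f)"
      using m unfolding B_def by blast
    have "m \<in> keys f" using f nz[of f] by simp
    then show "keys m \<subseteq> {0..n}" "mdeg m = d"
      using f IP by (auto simp: homogeneous_def)
  qed
  have finB: "finite (B d)" for d
    by (rule finite_subset[OF _ finite_monomials[of "{0..n}" d]]) (use B in auto)
  have exf: "\<exists>f\<in>I. homogeneous d f \<and> f \<notin> J \<and> Max (keys f) = Min (B d)" if "d \<in> ?D" for d
  proof -
    have "B d \<noteq> {}" using that by (auto simp: B_def)
    then have "Min (B d) \<in> B d" using finB by simp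
    then show ?thesis by (force simp: B_def)
  qed
  assume inf: "infinite ?D"
  define e where "e = enumerate ?D"
  have e: "strict_mono e" "e i \<in> ?D" for i
    using strict_mono_enumerate[OF inf] enumerate_in_set[OF inf] by (auto simp: e_def)
  obtain F where F: "F i \<in> I" "homogeneous (e i) (F i)" "F i \<notin> J"
      "Max (keys (F i)) = Min (B (e i))" for i
    using exf[OF e(2)] by metis
  obtain u :: "nat \<Rightarrow> nat" where u: "strict_mono u"
    and le: "\<forall>v\<in>{0..n}. \<forall>i j. i \<le> j \<longrightarrow>
      lookup (Max (keys (F (u i)))) v \<le> lookup (Max (keys (F (u j)))) v"
    using dickson[of "{0..n}" "\<lambda>i. lookup (Max (keys (F i)))"] by blast
  \<comment> \<open>Two members of the subsequence suffice: the leading monomial of \<open>f\<close>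
    divides that of \<open>g\<close>, so the truncated subtraction in \<open>a\<close> is an honest
    one.\<close>
  define f g where "f = F (u 0)" and "g = F (u 1)"
  define a where "a = Max (keys g) - Max (keys f)"
  have fg: "f \<noteq> 0" "g \<noteq> 0" using F(3) nz by (auto simp: f_def g_def)
  have "lookup (Max (keys f)) v \<le> lookup (Max (keys g)) v" for v
  proof (cases "v \<in> {0..n}")
    case True then show ?thesis using le by (simp add: f_def g_def)
  next
    case False
    have "keys (Max (keys f)) \<subseteq> {0..n}"
      using fg F(1) by (intro IP[of f]) (auto simp: f_def)
    then have "v \<notin> keys (Max (keys f))" using False by blast
    then show ?thesis by (simp add: in_keys_iff)
  qed
  then have Mg: "Max (keys g) = a + Max (keys f)"
    by (intro poly_mapping_eqI) (simp add: a_def lookup_add lookup_minus)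
  let ?s = "single a (lookup g (Max (keys g)) / lookup f (Max (keys f)))"
  define h where "h = g - ?s * f"
  have "mdeg (Max (keys f)) = e (u 0)" "mdeg (Max (keys g)) = e (u 1)"
    using F(2) fg by (auto simp: f_def g_def homogeneous_def)
  then have deg: "e (u 1) = mdeg a + e (u 0)" using Mg by (simp add: mdeg_add)
  \<comment> \<open>The degrees differ strictly, hence \<open>a\<close> is not the trivial monomial
    and the multiplier \<open>?s\<close> lies in the irrelevant ideal. This puts
    \<open>?s * f\<close> into \<open>J\<close>.\<close>
  have "e (u 0) < e (u 1)" using u e(1) by (simp add: strict_mono_less)
  then have "a \<noteq> 0" using deg by auto
  moreover have "keys a \<subseteq> {0..n}"
  proof -
    have "keys (Max (keys g)) \<subseteq> {0..n}"
      using fg F(1) by (intro IP[of g]) (auto simp: g_def)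
    then show ?thesis unfolding Mg keys_nat_add by blast
  qed
  ultimately have s: "?s \<in> irrelevant n"
    by (auto simp: irrelevant_eq polys_in_single lookup_single)
  have "?s \<otimes>\<^bsub>PR n\<^esub> f \<in> J"
    unfolding J_def using s F(1) by (auto simp: f_def intro!: ideal_prod.prod simp del: PR_sel)
  then have sJ: "?s * f \<in> J" by simp
  have hJ: "h \<notin> J"
  proof
    assume "h \<in> J"
    then have "h + ?s * f \<in> J" using J.a_closed[OF _ sJ] by simp
    then show False using F(3) by (simp add: h_def g_def)
  qed
  have "\<ominus>\<^bsub>PR n\<^esub> (?s * f) \<in> I" "?s * f \<in> I"
    using sJ P.ideal_prod_inter[OF M I] I.a_inv_closed unfolding J_def by blast+
  then have "- (?s * f) \<in> I" using I.a_subset by (auto simp: PR_uminus)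
  then have "h \<in> I" using I.a_closed[of g "- (?s * f)"] F(1) by (simp add: h_def g_def)
  moreover have "homogeneous (e (u 1)) h"
  proof -
    have "homogeneous (e (u 1)) g" using F(2) by (simp add: g_def)
    moreover have "homogeneous (e (u 1)) (?s * f)"
      unfolding deg f_def by (rule homogeneous_mult[OF homogeneous_single F(2)])
    ultimately show ?thesis unfolding h_def by (rule homogeneous_diff)
  qed
  \<comment> \<open>\<open>h\<close> competes with \<open>g\<close> in the same degree but has a
    smaller leading monomial, against the choice of \<open>g\<close>.\<close>
  ultimately have "Max (keys h) \<in> B (e (u 1))" using hJ by (auto simp: B_def)
  then have "Max (keys g) \<le> Max (keys h)" using F(4) finB by (simp add: g_def)
  moreover have "Max (keys h) < Max (keys g)"
    unfolding h_def using leading_monomial_cancel[OF fg Mg] nz[OF hJ] by (simp add: h_def)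
  ultimately show False by simp
qed

section \<open>The universal property of Kaehler differentials\<close>

locale kaehler_module = cring R for R :: "('a, 'm) ring_scheme" (structure) +
  fixes C :: "'a set" assumes C: "C \<subseteq> carrier R"
begin

abbreviation "F \<equiv> free_module R (carrier R)"
abbreviation "rels \<equiv> kaehler_rel_module R C"
abbreviation "\<Omega> \<equiv> kaehler R C"
abbreviation d where "d \<equiv> kaehler_d R C"

lemma F_module: "plain_module R F"
  by (rule free_module_plain)

lemma F_minus_closed: "v \<in> carrier F \<Longrightarrow> w \<in> carrier F \<Longrightarrow> v \<ominus>\<^bsub>F\<^esub> w \<in> carrier F"
proof -
  interpret F: plain_module R F by (rule F_module)
  show "v \<in> carrier F \<Longrightarrow> w \<in> carrier F \<Longrightarrow> v \<ominus>\<^bsub>F\<^esub> w \<in> carrier F"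
    by (rule F.M.minus_closed)
qed

lemma F_closed:
  "v \<in> carrier F \<Longrightarrow> w \<in> carrier F \<Longrightarrow> v \<oplus>\<^bsub>F\<^esub> w \<in> carrier F"
  "r \<in> carrier R \<Longrightarrow> v \<in> carrier F \<Longrightarrow> r \<odot>\<^bsub>F\<^esub> v \<in> carrier F"
proof -
  interpret F: plain_module R F by (rule F_module)
  show "v \<in> carrier F \<Longrightarrow> w \<in> carrier F \<Longrightarrow> v \<oplus>\<^bsub>F\<^esub> w \<in> carrier F"
    by (rule F.M.a_closed)
  show "r \<in> carrier R \<Longrightarrow> v \<in> carrier F \<Longrightarrow> r \<odot>\<^bsub>F\<^esub> v \<in> carrier F"
    by (rule F.smult_closed)
qed

lemma relations_carrier: "kaehler_relations R C \<subseteq> carrier F"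
  unfolding kaehler_relations_def Let_def
  using C by (auto intro!: F_minus_closed F_closed basis_vec_carrier simp del: free_module_sel)

lemma rels_quotient: "quotient_module R F rels"
proof -
  interpret F: plain_module R F by (rule F_module)
  show ?thesis
    unfolding kaehler_rel_module_def
    by (intro quotient_module.intro quotient_module_axioms.intro F_module
        F.mod_span_submodule relations_carrier)
qed

lemma relations_in_rels: "x \<in> kaehler_relations R C \<Longrightarrow> x \<in> rels"
  unfolding kaehler_rel_module_def mod_span_def by blast

lemma Omega_module: "plain_module R \<Omega>"
  unfolding kaehler_def by (rule quotient_module.quot_plain_module[OF rels_quotient])

lemma d_closed: "a \<in> carrier R \<Longrightarrow> d a \<in> carrier \<Omega>"
  unfolding kaehler_def kaehler_d_def
  by (intro quotient_module.proj_closed[OF rels_quotient] basis_vec_carrier)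

lemma d_add:
  assumes "a \<in> carrier R" "b \<in> carrier R" shows "d (a \<oplus> b) = d a \<oplus>\<^bsub>\<Omega>\<^esub> d b"
proof -
  interpret K: quotient_module R F rels by (rule rels_quotient)
  let ?e = "basis_vec R"
  have e: "?e x \<in> carrier F" if "x \<in> carrier R" for x
    using that by (rule basis_vec_carrier)
  have "?e (a \<oplus> b) \<ominus>\<^bsub>F\<^esub> (?e a \<oplus>\<^bsub>F\<^esub> ?e b) \<in> rels"
    using assms unfolding kaehler_relations_def Let_def by (intro relations_in_rels) (auto simp: kaehler_relations_def Let_def)
  then have "K.proj (?e (a \<oplus> b)) = K.proj (?e a \<oplus>\<^bsub>F\<^esub> ?e b)"
    by (subst K.proj_eq_iff) (use assms e in \<open>auto intro!: F_closed simp del: free_module_sel\<close>)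
  then show ?thesis
    unfolding kaehler_def kaehler_d_def using K.proj_add[OF e e] assms by simp
qed

lemma d_mult:
  assumes "a \<in> carrier R" "b \<in> carrier R" shows "d (a \<otimes> b) = a \<odot>\<^bsub>\<Omega>\<^esub> d b \<oplus>\<^bsub>\<Omega>\<^esub> b \<odot>\<^bsub>\<Omega>\<^esub> d a"
proof -
  interpret K: quotient_module R F rels by (rule rels_quotient)
  let ?e = "basis_vec R"
  have e: "?e x \<in> carrier F" if "x \<in> carrier R" for x
    using that by (rule basis_vec_carrier)
  have "?e (a \<otimes> b) \<ominus>\<^bsub>F\<^esub> (a \<odot>\<^bsub>F\<^esub> ?e b \<oplus>\<^bsub>F\<^esub> b \<odot>\<^bsub>F\<^esub> ?e a) \<in> rels"
    using assms by (intro relations_in_rels) (auto simp: kaehler_relations_def Let_def)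
  then have "K.proj (?e (a \<otimes> b)) = K.proj (a \<odot>\<^bsub>F\<^esub> ?e b \<oplus>\<^bsub>F\<^esub> b \<odot>\<^bsub>F\<^esub> ?e a)"
    by (subst K.proj_eq_iff) (use assms e in \<open>auto intro!: F_closed simp del: free_module_sel\<close>)
  then show ?thesis
    unfolding kaehler_def kaehler_d_def
    using assms e by (simp add: K.proj_add K.proj_smult F_closed del: free_module_sel)
qed

lemma d_const:
  assumes "c \<in> C" shows "d c = \<zero>\<^bsub>\<Omega>\<^esub>"
proof -
  interpret K: quotient_module R F rels by (rule rels_quotient)
  have "basis_vec R c \<in> rels"
    using assms by (intro relations_in_rels) (auto simp: kaehler_relations_def Let_def)
  then show ?thesis
    unfolding kaehler_def kaehler_d_def
    using assms C by (subst K.proj_eq_zero_iff) (auto intro: basis_vec_carrier)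
qed

text \<open>The preimage of \<open>N\<close> in the free module is a submodule with all basis
  vectors in it, hence everything.\<close>

lemma generated:
  assumes N: "submodule N R \<Omega>" and dN: "\<And>a. a \<in> carrier R \<Longrightarrow> d a \<in> N"
  shows "carrier \<Omega> \<subseteq> N"
proof -
  interpret K: quotient_module R F rels by (rule rels_quotient)
  interpret O: plain_module R \<Omega> by (rule Omega_module)
  let ?N = "{v \<in> carrier F. K.proj v \<in> N}"
  have "submodule ?N R F"
  proof (rule K.submoduleI)
    show "\<zero>\<^bsub>F\<^esub> \<in> ?N"
      using O.submodule_zero[OF N] K.proj_eq_zero_iff[OF K.M.zero_closed] K.N.zero_closed
      by (simp add: kaehler_def del: free_module_sel)
  next
    fix v assume v: "v \<in> ?N"
    interpret p: linear_map R F \<Omega> K.proj unfolding kaehler_def by (rule K.proj_linear)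
    show "\<ominus>\<^bsub>F\<^esub> v \<in> ?N" using v O.submoduleE(3)[OF N] by (auto simp: p.neg)
  next
    fix v w assume "v \<in> ?N" "w \<in> ?N"
    then show "v \<oplus>\<^bsub>F\<^esub> w \<in> ?N" using O.submoduleE(5)[OF N]
      by (auto simp: K.proj_add[symmetric] kaehler_def F_closed simp del: free_module_sel)
  next
    fix r v assume "r \<in> carrier R" "v \<in> ?N"
    then show "r \<odot>\<^bsub>F\<^esub> v \<in> ?N" using O.submoduleE(4)[OF N]
      by (auto simp: K.proj_smult[symmetric] kaehler_def F_closed simp del: free_module_sel)
  qed auto
  then have "carrier F \<subseteq> ?N"
    using dN by (intro free_module_generated) (auto simp: kaehler_d_def intro: basis_vec_carrier)
  then show ?thesis
    unfolding kaehler_def K.quot_carrier by blast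
qed

text \<open>The linear extension of \<open>D\<close> to the free module kills each of the three
  kinds of relations by the matching assumption on \<open>D\<close>, so it factors through the
  quotient.\<close>

lemma universal:
  assumes N: "plain_module R N" and D: "D \<in> carrier R \<rightarrow> carrier N"
    and add: "\<And>a b. a \<in> carrier R \<Longrightarrow> b \<in> carrier R \<Longrightarrow> D (a \<oplus> b) = D a \<oplus>\<^bsub>N\<^esub> D b"
    and leibniz: "\<And>a b. a \<in> carrier R \<Longrightarrow> b \<in> carrier R \<Longrightarrow>
      D (a \<otimes> b) = a \<odot>\<^bsub>N\<^esub> D b \<oplus>\<^bsub>N\<^esub> b \<odot>\<^bsub>N\<^esub> D a"
    and const: "\<And>c. c \<in> C \<Longrightarrow> D c = \<zero>\<^bsub>N\<^esub>"
  obtains h where "h \<in> lin_maps R \<Omega> N" "\<And>a. a \<in> carrier R \<Longrightarrow> h (d a) = D a"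
proof -
  interpret K: quotient_module R F rels by (rule rels_quotient)
  interpret N: plain_module R N by (rule N)
  define \<phi> where "\<phi> = (\<lambda>v. finsum N (\<lambda>a. v a \<odot>\<^bsub>N\<^esub> D a) {a. v a \<noteq> \<zero>})"
  have lin: "linear_map R F N \<phi>" and \<phi>: "\<And>a. a \<in> carrier R \<Longrightarrow> \<phi> (basis_vec R a) = D a"
    unfolding \<phi>_def using N.free_module_lift[OF D] by blast+
  interpret \<phi>: linear_map R F N \<phi> by (rule lin)
  let ?e = "basis_vec R"
  have e: "?e x \<in> carrier F" if "x \<in> carrier R" for x
    using that by (rule basis_vec_carrier)
  have DN: "D x \<in> carrier N" if "x \<in> carrier R" for x using D that by blast
  have ker: "v \<ominus>\<^bsub>F\<^esub> w \<in> a_kernel F N \<phi>" if "v \<in> carrier F" "w \<in> carrier F" "\<phi> v = \<phi> w" for v w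
    using that \<phi>.minus[OF that(1,2)] \<phi>.closed[OF that(1)] F_minus_closed
    by (simp add: a_kernel_def' N.minus_eq_zero_iff)
  have "rels \<subseteq> a_kernel F N \<phi>"
    unfolding kaehler_rel_module_def
  proof (rule K.mod_span_least[OF \<phi>.kernel_submodule])
    have "?e (a \<oplus> b) \<ominus>\<^bsub>F\<^esub> (?e a \<oplus>\<^bsub>F\<^esub> ?e b) \<in> a_kernel F N \<phi>"
      if "a \<in> carrier R" "b \<in> carrier R" for a b
      using that by (intro ker F_closed e) (simp_all add: \<phi>.add e \<phi> add del: free_module_sel)
    moreover have "?e (a \<otimes> b) \<ominus>\<^bsub>F\<^esub> (a \<odot>\<^bsub>F\<^esub> ?e b \<oplus>\<^bsub>F\<^esub> b \<odot>\<^bsub>F\<^esub> ?e a) \<in> a_kernel F N \<phi>"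
      if "a \<in> carrier R" "b \<in> carrier R" for a b
      using that
      by (intro ker F_closed e) (simp_all add: \<phi>.add \<phi>.smult F_closed e \<phi> leibniz del: free_module_sel)
    moreover have "?e c \<in> a_kernel F N \<phi>" if "c \<in> C" for c
      using that C by (auto simp: a_kernel_def' e \<phi> const)
    ultimately show "kaehler_relations R C \<subseteq> a_kernel F N \<phi>"
      unfolding kaehler_relations_def Let_def by blast
  qed
  then obtain h where h: "h \<in> lin_maps R K.Q N" "\<And>x. x \<in> carrier F \<Longrightarrow> h (K.proj x) = \<phi> x"
    using K.lift_linear[OF lin] by blast
  show thesis
  proof (rule that)
    show "h \<in> lin_maps R \<Omega> N" using h by (simp add: kaehler_def)
    show "h (d a) = D a" if "a \<in> carrier R" for a
      using h(2)[OF e[OF that]] \<phi>[OF that] by (simp add: kaehler_d_def)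
  qed
qed

end

section \<open>Differentials of the homogeneous coordinate ring\<close>

lemma ring_module_sel [simp]:
  "x \<oplus>\<^bsub>ring_module R\<^esub> y = x \<oplus>\<^bsub>R\<^esub> y" "r \<odot>\<^bsub>ring_module R\<^esub> x = r \<otimes>\<^bsub>R\<^esub> x"
  "\<zero>\<^bsub>ring_module R\<^esub> = \<zero>\<^bsub>R\<^esub>" "carrier (ring_module R) = carrier R"
  by (simp_all add: ring_module_def)

lemma (in ideal) ideal_module:
  assumes "cring R" shows "plain_module R ((ring_module R)\<lparr>carrier := I\<rparr>)"
proof -
  interpret cring R by fact
  show ?thesis unfolding plain_module_def
  proof (rule Module.moduleI)
    show "abelian_group ((ring_module R)\<lparr>carrier := I\<rparr>)"
    proof (rule abelian_groupI)
      fix x assume "x \<in> carrier ((ring_module R)\<lparr>carrier := I\<rparr>)"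
      then show "\<exists>y\<in>carrier ((ring_module R)\<lparr>carrier := I\<rparr>).
          y \<oplus>\<^bsub>(ring_module R)\<lparr>carrier := I\<rparr>\<^esub> x = \<zero>\<^bsub>(ring_module R)\<lparr>carrier := I\<rparr>\<^esub>"
        using Icarr by (intro bexI[of _ "\<ominus> x"]) (auto simp: l_neg)
    qed (use Icarr in \<open>auto simp: a_ac\<close>)
  qed (use Icarr I_l_closed in \<open>auto simp: l_distr r_distr m_assoc is_cring\<close>)
qed

text \<open>Homogeneity makes the Euler operator descend to \<open>R\<close>; containment in the
  irrelevant ideal puts \<open>I\<close> inside the domain of \<open>theta\<close>.\<close>

locale proj_scheme =
  fixes n :: nat and I :: "'k::field mpoly set"
  assumes homogeneous_I: "homogeneous_ideal n I" and I_irrelevant: "I \<subseteq> irrelevant n"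
begin

abbreviation "R \<equiv> coord_ring n I"
abbreviation "\<Omega> \<equiv> Omega n I"
abbreviation "cl \<equiv> cls n I"
abbreviation "U \<equiv> koszul n I"
abbreviation "V \<equiv> free_module (PR n) {0..n} :: ('k mpoly, nat \<Rightarrow> 'k mpoly) module"
abbreviation "Q \<equiv> quot_module \<Omega> U"
abbreviation "E \<equiv> (ring_module R)\<lparr>carrier := coord_max n I\<rparr>"
abbreviation "Pol \<equiv> polys_in {0..n} :: 'k mpoly set"

section \<open>The coordinate ring as a quotient of the polynomial ring\<close>

lemma ideal_I: "ideal I (PR n)"
  using homogeneous_I by (simp add: homogeneous_ideal_def)

lemma I_Pol: "f \<in> I \<Longrightarrow> f \<in> Pol"
  using I_irrelevant by (auto simp: irrelevant_eq)

lemma R_cring: "cring R"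
  unfolding coord_ring_def by (rule ideal.quotient_is_cring[OF ideal_I PR_cring])

sublocale R: cring R by (rule R_cring)

lemma cl_hom: "ring_hom_cring (PR n) R cl"
proof -
  have "cl = (+>\<^bsub>PR n\<^esub>) I" by (auto simp: cls_def)
  then show ?thesis
    unfolding coord_ring_def by (simp add: ideal.rcos_ring_hom_cring[OF ideal_I PR_cring])
qed

lemma cl_closed [simp]: "f \<in> Pol \<Longrightarrow> cl f \<in> carrier R"
  using ring_hom_closed[OF ring_hom_cring.homh[OF cl_hom], of f]
  by (simp add: PR_carrier)

lemma cl_add: "f \<in> Pol \<Longrightarrow> g \<in> Pol \<Longrightarrow> cl (f + g) = cl f \<oplus>\<^bsub>R\<^esub> cl g"
  using ring_hom_add[OF ring_hom_cring.homh[OF cl_hom], of f g] by (simp add: PR_carrier)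

lemma cl_mult: "f \<in> Pol \<Longrightarrow> g \<in> Pol \<Longrightarrow> cl (f * g) = cl f \<otimes>\<^bsub>R\<^esub> cl g"
  using ring_hom_mult[OF ring_hom_cring.homh[OF cl_hom], of f g] by (simp add: PR_carrier)

lemma cl_one: "cl 1 = \<one>\<^bsub>R\<^esub>"
  using ring_hom_one[OF ring_hom_cring.homh[OF cl_hom]] by simp

lemma cl_eq_zero_iff: "f \<in> Pol \<Longrightarrow> cl f = \<zero>\<^bsub>R\<^esub> \<longleftrightarrow> f \<in> I"
proof -
  interpret I: ideal I "PR n" by (rule ideal_I)
  assume "f \<in> Pol"
  then have "f \<in> carrier (PR n)" by (simp add: PR_carrier)
  moreover have "\<zero>\<^bsub>R\<^esub> = I" by (simp add: coord_ring_def FactRing_def)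
  ultimately show ?thesis
    unfolding cls_def using I.a_rcos_self I.a_coset_join2 I.a_subgroup by fastforce
qed

lemma I_zero: "0 \<in> I"
  using additive_subgroup.zero_closed[OF ideal.axioms(1)[OF ideal_I]] by simp

lemma cl_zero: "cl 0 = \<zero>\<^bsub>R\<^esub>"
  using I_zero by (simp add: cl_eq_zero_iff polys_in_zero)

lemma R_carrier: "carrier R = cl ` Pol"
  by (auto simp: coord_ring_def FactRing_def A_RCOSETS_def' cls_def PR_carrier)

lemma cl_eq_imp: "f \<in> Pol \<Longrightarrow> g \<in> Pol \<Longrightarrow> cl f = cl g \<Longrightarrow> f - g \<in> I"
proof -
  assume fg: "f \<in> Pol" "g \<in> Pol" "cl f = cl g"
  have "cl f = cl (f - g) \<oplus>\<^bsub>R\<^esub> cl g"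
    using fg cl_add[of "f - g" g] by (simp add: polys_in_diff)
  then have "cl (f - g) = \<zero>\<^bsub>R\<^esub>"
    using fg by (simp add: polys_in_diff)
  then show ?thesis using fg by (simp add: cl_eq_zero_iff polys_in_diff)
qed

sublocale K: kaehler_module R "cl ` range const"
  by unfold_locales (auto simp: polys_in_const)

lemma Omega_kaehler: "\<Omega> = kaehler R (cl ` range const)"
  by (simp add: Omega_def)

lemma dx_kaehler: "dx n I i = K.d (cl (X i))"
  by (simp add: dx_def)

sublocale O: plain_module R \<Omega>
  using K.Omega_module by (simp add: Omega_kaehler)

lemma dx_closed [simp]: "i \<le> n \<Longrightarrow> dx n I i \<in> carrier \<Omega>"
  using K.d_closed[of "cl (X i)"] by (simp add: dx_kaehler Omega_kaehler polys_in_X)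

section \<open>The map \<open>gamma\<close> from tuples of polynomials onto the
  differentials\<close>

lemma V_carrier: "v \<in> carrier V \<longleftrightarrow> (\<forall>i. v i \<in> Pol) \<and> (\<forall>i>n. v i = 0)"
proof
  assume v: "v \<in> carrier V"
  then have "v i \<in> Pol" "i > n \<Longrightarrow> v i = 0" for i
    using cring.free_module_val[OF PR_cring v] by (auto simp: free_module_carrier PR_carrier)
  then show "(\<forall>i. v i \<in> Pol) \<and> (\<forall>i>n. v i = 0)" by blast
next
  assume v: "(\<forall>i. v i \<in> Pol) \<and> (\<forall>i>n. v i = 0)"
  then have "{i. v i \<noteq> 0} \<subseteq> {..n}" by (metis (mono_tags, lifting) atMost_iff linorder_not_le mem_Collect_eq subsetI)
  then have "finite {i. v i \<noteq> 0}" by (rule finite_subset) simp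
  then show "v \<in> carrier V" using v by (simp add: free_module_carrier PR_carrier)
qed

lemma gamma_term [simp]: "v \<in> carrier V \<Longrightarrow> i \<le> n \<Longrightarrow> cl (v i) \<odot>\<^bsub>\<Omega>\<^esub> dx n I i \<in> carrier \<Omega>"
  by (simp add: V_carrier)

lemma gamma_closed: "v \<in> carrier V \<Longrightarrow> gamma n I v \<in> carrier \<Omega>"
  unfolding gamma_def by (intro O.M.finsum_closed) auto

lemma gamma_add:
  assumes "v \<in> carrier V" "w \<in> carrier V"
  shows "gamma n I (\<lambda>i. v i + w i) = gamma n I v \<oplus>\<^bsub>\<Omega>\<^esub> gamma n I w"
proof -
  have "gamma n I (\<lambda>i. v i + w i)
      = finsum \<Omega> (\<lambda>i. cl (v i) \<odot>\<^bsub>\<Omega>\<^esub> dx n I i \<oplus>\<^bsub>\<Omega>\<^esub> cl (w i) \<odot>\<^bsub>\<Omega>\<^esub> dx n I i) {0..n}"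
    unfolding gamma_def using assms
    by (intro O.M.finsum_cong') (auto simp: V_carrier cl_add O.smult_l_distr)
  also have "\<dots> = gamma n I v \<oplus>\<^bsub>\<Omega>\<^esub> gamma n I w"
    unfolding gamma_def using assms by (intro O.M.finsum_addf) auto
  finally show ?thesis .
qed

lemma gamma_smult:
  assumes "f \<in> Pol" "v \<in> carrier V"
  shows "gamma n I (\<lambda>i. f * v i) = cl f \<odot>\<^bsub>\<Omega>\<^esub> gamma n I v"
proof -
  have "gamma n I (\<lambda>i. f * v i) = finsum \<Omega> (\<lambda>i. cl f \<odot>\<^bsub>\<Omega>\<^esub> (cl (v i) \<odot>\<^bsub>\<Omega>\<^esub> dx n I i)) {0..n}"
    unfolding gamma_def using assms
    by (intro O.M.finsum_cong') (auto simp: V_carrier cl_mult O.smult_assoc1)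
  also have "\<dots> = cl f \<odot>\<^bsub>\<Omega>\<^esub> gamma n I v"
    unfolding gamma_def using assms by (intro O.finsum_smult_ldistr[symmetric]) auto
  finally show ?thesis .
qed

lemma single_V: "f \<in> Pol \<Longrightarrow> i \<le> n \<Longrightarrow> (\<lambda>j. if j = i then f else 0) \<in> carrier V"
  by (auto simp: V_carrier polys_in_zero)

lemma gamma_single:
  assumes "f \<in> Pol" "i \<le> n"
  shows "gamma n I (\<lambda>j. if j = i then f else 0) = cl f \<odot>\<^bsub>\<Omega>\<^esub> dx n I i"
proof -
  have "gamma n I (\<lambda>j. if j = i then f else 0)
      = finsum \<Omega> (\<lambda>j. if i = j then cl f \<odot>\<^bsub>\<Omega>\<^esub> dx n I j else \<zero>\<^bsub>\<Omega>\<^esub>) {0..n}"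
    unfolding gamma_def using assms
    by (intro O.M.finsum_cong') (auto simp: cl_zero O.smult_l_null)
  also have "\<dots> = cl f \<odot>\<^bsub>\<Omega>\<^esub> dx n I i"
    using assms by (intro O.M.add.finprod_singleton) auto
  finally show ?thesis .
qed

lemma gamma_basis_vec: "i \<le> n \<Longrightarrow> gamma n I (basis_vec (PR n) i) = dx n I i"
  unfolding basis_vec_def PR_sel using gamma_single[of 1 i] by (simp add: polys_in_one cl_one)

lemma V_add: "v \<in> carrier V \<Longrightarrow> w \<in> carrier V \<Longrightarrow> (\<lambda>i. v i + w i) \<in> carrier V"
  and V_smult: "f \<in> Pol \<Longrightarrow> v \<in> carrier V \<Longrightarrow> (\<lambda>i. f * v i) \<in> carrier V"
  and V_zero: "(\<lambda>i. 0) \<in> carrier V"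
  by (auto simp: V_carrier polys_in_add polys_in_mult polys_in_zero)

lemma gamma_zero: "gamma n I (\<lambda>i. 0) = \<zero>\<^bsub>\<Omega>\<^esub>"
  using gamma_smult[OF polys_in_zero V_zero] gamma_closed[OF V_zero]
  by (simp add: cl_zero O.smult_l_null)

lemma gamma_image_submodule: "submodule (gamma n I ` carrier V) R \<Omega>"
proof (rule O.submoduleI)
  show "gamma n I ` carrier V \<subseteq> carrier \<Omega>" using gamma_closed by blast
  show "\<zero>\<^bsub>\<Omega>\<^esub> \<in> gamma n I ` carrier V" using V_zero gamma_zero by (metis imageI)
  show smult: "r \<odot>\<^bsub>\<Omega>\<^esub> x \<in> gamma n I ` carrier V"
    if "r \<in> carrier R" "x \<in> gamma n I ` carrier V" for r x
    using that by (auto simp: R_carrier gamma_smult[symmetric] intro!: imageI V_smult)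
  show "\<ominus>\<^bsub>\<Omega>\<^esub> x \<in> gamma n I ` carrier V" if x: "x \<in> gamma n I ` carrier V" for x
  proof -
    have xc: "x \<in> carrier \<Omega>" using x gamma_closed by blast
    then have "\<ominus>\<^bsub>\<Omega>\<^esub> x = (\<ominus>\<^bsub>R\<^esub> \<one>\<^bsub>R\<^esub>) \<odot>\<^bsub>\<Omega>\<^esub> x" by (simp add: O.smult_l_minus)
    then show ?thesis using smult[OF _ x] by simp
  qed
  show "x \<oplus>\<^bsub>\<Omega>\<^esub> y \<in> gamma n I ` carrier V"
    if "x \<in> gamma n I ` carrier V" "y \<in> gamma n I ` carrier V" for x y
    using that by (auto simp: gamma_add[symmetric] intro!: imageI V_add)
qed

text \<open>The Leibniz rule peels one variable after another off a term, by induction on the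
  degree, until a constant is left, whose differential is zero. Additivity extends this to all
  differentials \<open>d a\<close>, and these generate.\<close>

lemma gamma_surj: "gamma n I ` carrier V = carrier \<Omega>"
proof
  show "gamma n I ` carrier V \<subseteq> carrier \<Omega>" using gamma_closed by blast
  let ?N = "gamma n I ` carrier V"
  note N = gamma_image_submodule
  have dxN: "dx n I i \<in> ?N" if "i \<le> n" for i
    using imageI[OF single_V[OF polys_in_one that], of "gamma n I"] gamma_basis_vec[OF that]
    unfolding basis_vec_def PR_sel by simp
  have mono: "K.d (cl (single m c)) \<in> ?N" if "keys m \<subseteq> {0..n}" for m :: "nat \<Rightarrow>\<^sub>0 nat" and c :: 'k
    using that
  proof (induction "mdeg m" arbitrary: m rule: less_induct)
    case less
    show ?case
    proof (cases "m = 0")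
      case True
      then have "K.d (cl (single m c)) = \<zero>\<^bsub>\<Omega>\<^esub>"
        using K.d_const[of "cl (single m c)"] by (auto simp: const_def Omega_kaehler)
      then show ?thesis using O.submodule_zero[OF N] by simp
    next
      case False
      then obtain i k where ik: "m = k + single i 1" "i \<in> keys m" "keys k \<subseteq> keys m"
        by (rule monomial_split)
      have i: "i \<le> n" using ik less.prems by auto
      have k: "single k c \<in> Pol" "X i \<in> Pol"
        using ik less.prems i by (auto intro!: polys_in_single polys_in_X)
      have "K.d (cl (single k c)) \<in> ?N"
        using ik less.prems by (intro less.hyps) (auto simp: mdeg_add)
      then have "cl (single k c) \<odot>\<^bsub>\<Omega>\<^esub> dx n I i \<oplus>\<^bsub>\<Omega>\<^esub> cl (X i) \<odot>\<^bsub>\<Omega>\<^esub> K.d (cl (single k c)) \<in> ?N"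
        using k i by (intro O.submoduleE(4,5)[OF N] dxN cl_closed)
      moreover have "single m c = single k c * X i"
        by (simp add: ik(1) X_def mult_single)
      ultimately show ?thesis
        using k K.d_mult[OF cl_closed[OF k(1)] cl_closed[OF k(2)]]
        by (simp add: cl_mult Omega_kaehler dx_kaehler)
    qed
  qed
  have "K.d (cl f) \<in> ?N" if "f \<in> Pol" for f
    using that
  proof (induction f rule: mpoly_induct)
    case (add f g)
    then show ?case
      using K.d_add[of "cl f" "cl g"] O.submoduleE(5)[OF N, of "K.d (cl f)" "K.d (cl g)"]
      by (simp add: cl_add Omega_kaehler)
  qed (rule mono)
  then show "carrier \<Omega> \<subseteq> ?N"
    using K.generated N unfolding Omega_kaehler R_carrier by blast
qed

subsection \<open>The Koszul submodule and the map \<open>\<delta>\<close>\<close>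

lemma koszul_gen_closed:
  "i \<le> n \<Longrightarrow> j \<le> n \<Longrightarrow>
    cl (X i) \<odot>\<^bsub>\<Omega>\<^esub> dx n I j \<ominus>\<^bsub>\<Omega>\<^esub> cl (X j) \<odot>\<^bsub>\<Omega>\<^esub> dx n I i \<in> carrier \<Omega>"
  by (intro O.M.minus_closed) (auto simp: polys_in_X)

lemma koszul_submodule: "submodule U R \<Omega>"
  unfolding koszul_def by (rule O.mod_span_submodule) (auto intro!: koszul_gen_closed)

lemma koszul_gen:
  "i < j \<Longrightarrow> j \<le> n \<Longrightarrow>
    cl (X i) \<odot>\<^bsub>\<Omega>\<^esub> dx n I j \<ominus>\<^bsub>\<Omega>\<^esub> cl (X j) \<odot>\<^bsub>\<Omega>\<^esub> dx n I i \<in> U"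
  unfolding koszul_def by (rule subsetD[OF O.mod_span_superset]) blast

sublocale Kz: quotient_module R \<Omega> U
  by (intro quotient_module.intro quotient_module_axioms.intro O.plain_module_axioms koszul_submodule)

lemma eta_proj: "eta n I = Kz.proj"
  by (auto simp: eta_def)

lemma eta_linear: "linear_map R \<Omega> Q (eta n I)"
  unfolding eta_proj by (rule Kz.proj_linear)

lemma theta_V: "F \<in> irrelevant n \<Longrightarrow> theta n F \<in> carrier V"
  by (auto simp: theta_eq V_carrier irrelevant_eq tri_beyond intro: polys_in_mono[OF _ tri_in_polys])

lemma sum_V: "v \<in> carrier V \<Longrightarrow> A \<subseteq> {0..n} \<Longrightarrow> (\<Sum>i\<in>A. v i * X i) \<in> irrelevant n"
  by (auto simp: irrelevant_eq V_carrier lookup_sum lookup_mult_zero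
      intro!: polys_in_sum polys_in_mult polys_in_X)

lemma theta_sum: "F \<in> irrelevant n \<Longrightarrow> (\<Sum>i=0..n. theta n F i * X i) = F"
  using tri_decomposition[of F n] by (simp add: theta_eq irrelevant_eq const_def)

lemma irrelevant_add: "F \<in> irrelevant n \<Longrightarrow> G \<in> irrelevant n \<Longrightarrow> F + G \<in> irrelevant n"
  and irrelevant_mult: "f \<in> Pol \<Longrightarrow> F \<in> irrelevant n \<Longrightarrow> f * F \<in> irrelevant n"
  by (auto simp: irrelevant_eq polys_in_add polys_in_mult lookup_add lookup_mult_zero)

lemma gamma_theta_closed: "F \<in> irrelevant n \<Longrightarrow> gamma n I (theta n F) \<in> carrier \<Omega>"
  by (intro gamma_closed theta_V)

lemma gamma_theta_add:
  assumes "F \<in> irrelevant n" "G \<in> irrelevant n"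
  shows "gamma n I (theta n (F + G)) = gamma n I (theta n F) \<oplus>\<^bsub>\<Omega>\<^esub> gamma n I (theta n G)"
  using assms gamma_add[OF theta_V theta_V, of F G]
  by (simp add: theta_eq irrelevant_add tri_add)

lemma delta_closed: "F \<in> irrelevant n \<Longrightarrow> delta n I F \<in> carrier Q"
  by (simp add: delta_def eta_proj Kz.proj_closed gamma_theta_closed)

lemma delta_add:
  assumes "F \<in> irrelevant n" "G \<in> irrelevant n"
  shows "delta n I (F + G) = delta n I F \<oplus>\<^bsub>Q\<^esub> delta n I G"
  using assms by (simp add: delta_def gamma_theta_add eta_proj Kz.proj_add gamma_theta_closed)

lemma delta_zero: "delta n I 0 = \<zero>\<^bsub>Q\<^esub>"
proof -
  have 0: "0 \<in> irrelevant n" by (simp add: irrelevant_eq polys_in_zero)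
  show ?thesis
    using gamma_zero Kz.proj_eq_zero_iff[OF O.M.zero_closed] Kz.N.zero_closed
    by (simp add: delta_def theta_eq[OF 0] eta_proj)
qed

text \<open>If \<open>X\<^sub>i\<close> is the first variable in \<open>m X\<^sub>j\<close> then \<open>m e\<^sub>j\<close> and the triangular \<open>(m X\<^sub>j / X\<^sub>i) e\<^sub>i\<close> differ
  by a multiple of one Koszul relation.\<close>

lemma eta_term:
  assumes "f \<in> Pol" "j \<le> n"
  shows "eta n I (cl f \<odot>\<^bsub>\<Omega>\<^esub> dx n I j) = delta n I (f * X j)"
  using assms(1)
proof (induction f rule: mpoly_induct)
  case (monom m c)
  have "m + single j 1 \<noteq> 0"
    by (metis UnCI empty_iff keys_nat_add keys_single keys_zero singletonI zero_neq_one)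
  then obtain i k where ik: "m + single j 1 = k + single i 1" "i \<in> keys (m + single j 1)"
      "keys k \<subseteq> {i..}" "keys k \<subseteq> keys (m + single j 1)"
    by (rule monomial_split)
  have keys: "keys (m + single j 1) = insert j (keys m)"
    by (simp add: keys_nat_add)
  have i: "i \<le> n" using ik(2) monom assms(2) unfolding keys by auto
  have kP: "single k c \<in> Pol"
    using ik(4) monom assms(2) unfolding keys by (intro polys_in_single) auto
  have eq: "single m c * X j = single k c * X i"
    using ik(1) by (simp add: X_def mult_single)
  have irr: "single k c * X i \<in> irrelevant n"
    using kP i by (simp add: irrelevant_eq polys_in_mult polys_in_X lookup_mult_zero)
  have "theta n (single k c * X i) = (\<lambda>l. if l = i then single k c else 0)"
    using ik(3) by (simp add: theta_eq[OF irr] tri_mult_X polys_in_single)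
  then have delta: "delta n I (single m c * X j) = eta n I (cl (single k c) \<odot>\<^bsub>\<Omega>\<^esub> dx n I i)"
    by (simp add: delta_def eq gamma_single[OF kP i])
  show ?case
  proof (cases "i = j")
    case True
    then show ?thesis using ik(1) delta by simp
  next
    case False
    then have im: "i \<in> keys m" using ik(2) unfolding keys by simp
    have "j \<in> keys (k + single i 1)" unfolding ik(1)[symmetric] keys by simp
    then have "j \<in> keys k" using False by (auto simp: keys_nat_add)
    then have ij: "i < j" using ik(3) False by auto
    \<comment> \<open>With \<open>p\<close> as common cofactor, \<open>m = p X\<^sub>i\<close> and
      \<open>k = p X\<^sub>j\<close>, so the two differentials differ by \<open>p\<close> times one
      Koszul generator. Since \<open>X\<^sub>i\<close> is the least variable, that generator has the
      orientation \<open>i < j\<close> in which it is listed.\<close>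
    define p where "p = m - single i 1"
    have m: "m = p + single i 1"
      using im by (intro poly_mapping_eqI)
        (auto simp: p_def lookup_add lookup_minus lookup_single when_def in_keys_iff)
    have "k + single i 1 = (p + single j 1) + single i 1"
      using ik(1) by (simp add: m ac_simps)
    then have k: "k = p + single j 1" by simp
    have pP: "single p c \<in> Pol"
      using monom unfolding m keys_nat_add by (intro polys_in_single) auto
    have XP: "X i \<in> Pol" "X j \<in> Pol" using i assms(2) by (auto intro: polys_in_X)
    have eqs: "single m c = single p c * X i" "single k c = single p c * X j"
      by (simp_all add: m k X_def mult_single)
    have "cl (single p c) \<odot>\<^bsub>\<Omega>\<^esub> (cl (X i) \<odot>\<^bsub>\<Omega>\<^esub> dx n I j \<ominus>\<^bsub>\<Omega>\<^esub> cl (X j) \<odot>\<^bsub>\<Omega>\<^esub> dx n I i) \<in> U"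
      using koszul_gen[OF ij assms(2)] O.submoduleE(4)[OF koszul_submodule] pP by simp
    also have "cl (single p c) \<odot>\<^bsub>\<Omega>\<^esub> (cl (X i) \<odot>\<^bsub>\<Omega>\<^esub> dx n I j \<ominus>\<^bsub>\<Omega>\<^esub> cl (X j) \<odot>\<^bsub>\<Omega>\<^esub> dx n I i)
        = cl (single m c) \<odot>\<^bsub>\<Omega>\<^esub> dx n I j \<ominus>\<^bsub>\<Omega>\<^esub> cl (single k c) \<odot>\<^bsub>\<Omega>\<^esub> dx n I i"
      unfolding eqs a_minus_def using pP XP i assms(2)
      by (simp add: cl_mult O.smult_assoc1 O.smult_r_distr O.smult_r_minus)
    finally have "eta n I (cl (single m c) \<odot>\<^bsub>\<Omega>\<^esub> dx n I j) = eta n I (cl (single k c) \<odot>\<^bsub>\<Omega>\<^esub> dx n I i)"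
      unfolding eta_proj using monom kP i assms(2)
      by (subst Kz.proj_eq_iff) (auto simp: polys_in_single)
    then show ?thesis using delta by simp
  qed
next
  case (add f g)
  have irr: "h * X j \<in> irrelevant n" if "h \<in> Pol" for h
    using that assms(2) by (simp add: irrelevant_eq polys_in_mult polys_in_X lookup_mult_zero)
  interpret \<eta>: linear_map R \<Omega> Q "eta n I" by (rule eta_linear)
  have "eta n I (cl (f + g) \<odot>\<^bsub>\<Omega>\<^esub> dx n I j)
      = eta n I (cl f \<odot>\<^bsub>\<Omega>\<^esub> dx n I j) \<oplus>\<^bsub>Q\<^esub> eta n I (cl g \<odot>\<^bsub>\<Omega>\<^esub> dx n I j)"
    using add(1,2) assms(2) by (simp add: cl_add O.smult_l_distr \<eta>.add)
  then show ?case
    using add irr by (simp add: distrib_right delta_add)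
qed

lemma eta_gamma:
  assumes v: "v \<in> carrier V"
  shows "eta n I (gamma n I v) = delta n I (\<Sum>i=0..n. v i * X i)"
proof -
  interpret \<eta>: linear_map R \<Omega> Q "eta n I" by (rule eta_linear)
  have vP: "v i \<in> Pol" for i using v by (simp add: V_carrier)
  have irr: "v i * X i \<in> irrelevant n" if "i \<le> n" for i
    using that vP by (simp add: irrelevant_eq polys_in_mult polys_in_X lookup_mult_zero)
  have "eta n I (finsum \<Omega> (\<lambda>i. cl (v i) \<odot>\<^bsub>\<Omega>\<^esub> dx n I i) A) = delta n I (\<Sum>i\<in>A. v i * X i)"
    if "finite A" "A \<subseteq> {0..n}" for A
    using that
  proof (induction A)
    case empty
    show ?case by (simp add: delta_zero \<eta>.zero)
  next
    case (insert i A)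
    have closed: "(\<lambda>i. cl (v i) \<odot>\<^bsub>\<Omega>\<^esub> dx n I i) \<in> A \<rightarrow> carrier \<Omega>"
      "cl (v i) \<odot>\<^bsub>\<Omega>\<^esub> dx n I i \<in> carrier \<Omega>"
      using insert.prems v by (auto intro!: gamma_term)
    have "eta n I (finsum \<Omega> (\<lambda>i. cl (v i) \<odot>\<^bsub>\<Omega>\<^esub> dx n I i) (insert i A))
        = delta n I (v i * X i) \<oplus>\<^bsub>Q\<^esub> delta n I (\<Sum>i\<in>A. v i * X i)"
      using insert closed vP by (simp add: \<eta>.add O.M.finsum_closed eta_term)
    then show ?case
      using insert irr sum_V[OF v, of A] by (simp add: delta_add)
  qed
  from this[of "{0..n}"] show ?thesis by (simp add: gamma_def)
qed

text \<open>The tuple \<open>f * theta n F i\<close> need not be triangular, but its sum against the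
  variables is \<open>f * F\<close>, which is all that \<open>eta_gamma\<close> asks for.\<close>

lemma delta_smult:
  assumes f: "f \<in> Pol" and F: "F \<in> irrelevant n"
  shows "delta n I (f * F) = cl f \<odot>\<^bsub>Q\<^esub> delta n I F"
proof -
  interpret \<eta>: linear_map R \<Omega> Q "eta n I" by (rule eta_linear)
  have "f * F = (\<Sum>i=0..n. f * theta n F i * X i)"
    by (subst theta_sum[OF F, symmetric]) (simp add: sum_distrib_left mult.assoc)
  then have "delta n I (f * F) = eta n I (gamma n I (\<lambda>i. f * theta n F i))"
    using eta_gamma[OF V_smult[OF f theta_V[OF F]]] by simp
  then show ?thesis
    using f F by (simp add: gamma_smult theta_V \<eta>.smult gamma_theta_closed delta_def)
qed

subsection \<open>The Euler form\<close>

text \<open>Here homogeneity enters: \<open>I\<close> contains every homogeneous component of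
  \<open>f\<close>, hence their combination \<open>euler_op f\<close>.\<close>

lemma euler_op_I: "f \<in> I \<Longrightarrow> euler_op f \<in> I"
proof -
  interpret I: ideal I "PR n" by (rule ideal_I)
  assume f: "f \<in> I"
  have *: "const c * hom_comp d f \<in> I" for c d
  proof -
    have "hom_comp d f \<in> I" using f homogeneous_I by (simp add: homogeneous_ideal_def)
    then have "const c \<otimes>\<^bsub>PR n\<^esub> hom_comp d f \<in> I"
      by (rule I.I_l_closed) (simp add: PR_carrier polys_in_const)
    then show ?thesis by simp
  qed
  have "(\<Sum>d\<in>A. const (of_nat d) * hom_comp d f) \<in> I" if "finite A" for A
    using that
  proof (induction A)
    case empty
    show ?case using I_zero by simp
  next
    case (insert d A)
    then show ?case
      using additive_subgroup.a_closed[OF ideal.axioms(1)[OF ideal_I], of "const (of_nat d) * hom_comp d f" "\<Sum>d\<in>A. const (of_nat d) * hom_comp d f"] *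
      by simp
  qed
  then show ?thesis by (simp add: euler_op_hom_comp)
qed

lemma coord_max_ideal: "ideal (coord_max n I) R"
  unfolding coord_max_def by (rule R.genideal_ideal) (auto simp: polys_in_X)

lemma E_module: "plain_module R E"
  by (rule ideal.ideal_module[OF coord_max_ideal R_cring])

lemma cl_irrelevant: "F \<in> irrelevant n \<Longrightarrow> cl F \<in> coord_max n I"
proof -
  interpret c: ring_hom_cring "PR n" R cl by (rule cl_hom)
  have "ideal {f \<in> carrier (PR n). cl f \<in> coord_max n I} (PR n)"
    by (rule ring_hom_ring.ideal_vimage[OF _ coord_max_ideal])
      (intro ring_hom_ringI2 c.R.ring_axioms R.ring_axioms c.homh)
  moreover have "cl (X i) \<in> coord_max n I" if "i \<in> {0..n}" for i
    unfolding coord_max_def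
    by (rule subsetD[OF R.genideal_self]) (use that in \<open>auto simp: polys_in_X\<close>)
  ultimately have "irrelevant n \<subseteq> {f \<in> carrier (PR n). cl f \<in> coord_max n I}"
    unfolding irrelevant_def
    by (intro c.R.genideal_minimal) (auto simp: PR_carrier polys_in_X)
  then show "F \<in> irrelevant n \<Longrightarrow> cl F \<in> coord_max n I" by blast
qed

text \<open>Stated for every linear map with the prescribed values on the \<open>dx n I i\<close>:
  the formula first yields the uniqueness behind the definite description \<open>euler_form\<close>
  and later computes its kernel.\<close>

lemma euler_linear_gamma:
  assumes h: "h \<in> lin_maps R \<Omega> E" and hdx: "\<And>i. i \<le> n \<Longrightarrow> h (dx n I i) = cl (X i)"
    and v: "v \<in> carrier V"
  shows "h (gamma n I v) = cl (\<Sum>i=0..n. v i * X i)"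
proof -
  interpret h: linear_map R \<Omega> E h
    by (intro linear_map.intro linear_map_axioms.intro O.plain_module_axioms E_module h)
  have vP: "v i \<in> Pol" for i using v by (simp add: V_carrier)
  have "h (finsum \<Omega> (\<lambda>i. cl (v i) \<odot>\<^bsub>\<Omega>\<^esub> dx n I i) A) = cl (\<Sum>i\<in>A. v i * X i)"
    if "finite A" "A \<subseteq> {0..n}" for A
    using that
  proof (induction A)
    case empty
    show ?case using h.zero by (simp add: cl_zero)
  next
    case (insert i A)
    have closed: "(\<lambda>i. cl (v i) \<odot>\<^bsub>\<Omega>\<^esub> dx n I i) \<in> A \<rightarrow> carrier \<Omega>"
      "cl (v i) \<odot>\<^bsub>\<Omega>\<^esub> dx n I i \<in> carrier \<Omega>"
      using insert.prems v by (auto intro!: gamma_term)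
    have P: "v i * X i \<in> Pol" "(\<Sum>i\<in>A. v i * X i) \<in> Pol" "X i \<in> Pol"
      using insert.prems vP by (auto intro!: polys_in_sum polys_in_mult polys_in_X)
    have hi: "h (cl (v i) \<odot>\<^bsub>\<Omega>\<^esub> dx n I i) = cl (v i * X i)"
      using insert.prems vP P(3) h.smult[of "cl (v i)" "dx n I i"] by (simp add: hdx cl_mult)
    have "h (finsum \<Omega> (\<lambda>i. cl (v i) \<odot>\<^bsub>\<Omega>\<^esub> dx n I i) (insert i A))
        = h (cl (v i) \<odot>\<^bsub>\<Omega>\<^esub> dx n I i) \<oplus>\<^bsub>E\<^esub> h (finsum \<Omega> (\<lambda>i. cl (v i) \<odot>\<^bsub>\<Omega>\<^esub> dx n I i) A)"
      using insert closed by (simp add: h.add O.M.finsum_closed)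
    also have "\<dots> = cl (v i * X i) \<oplus>\<^bsub>R\<^esub> cl (\<Sum>i\<in>A. v i * X i)"
      using hi insert by simp
    finally show ?case
      using insert.hyps P by (simp add: cl_add)
  qed
  from this[of "{0..n}"] show ?thesis by (simp add: gamma_def)
qed

text \<open>The Euler operator induces a derivation of \<open>R\<close> that kills constants and
  fixes each \<open>x\<^sub>i\<close>. It takes values in \<open>coord_max\<close> because
  \<open>euler_op f\<close> has no constant term. The Euler form is the linear map attached to
  it.\<close>

lemma euler_form_exists:
  "\<exists>h. h \<in> lin_maps R \<Omega> E \<and> (\<forall>i\<in>{0..n}. h (dx n I i) = cl (X i))"
proof -
  define D where "D a = cl (euler_op (SOME f. f \<in> Pol \<and> cl f = a))" for a
  \<comment> \<open>Independence of the representative: two of them differ by an element of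
    \<open>I\<close>, which \<open>euler_op\<close> keeps in \<open>I\<close>.\<close>
  have D: "D (cl f) = cl (euler_op f)" if f: "f \<in> Pol" for f
  proof -
    let ?g = "SOME g. g \<in> Pol \<and> cl g = cl f"
    have g: "?g \<in> Pol \<and> cl ?g = cl f" by (rule someI[of _ f]) (use f in simp)
    have "euler_op ?g = euler_op (?g - f) + euler_op f"
      by (simp add: euler_op_add[symmetric])
    moreover have "euler_op (?g - f) \<in> I"
      using g f by (intro euler_op_I cl_eq_imp) auto
    ultimately show ?thesis
      using f I_Pol unfolding D_def
      by (simp add: cl_add euler_op_polys_in cl_eq_zero_iff[THEN iffD2])
  qed
  have irr: "euler_op f \<in> irrelevant n" if "f \<in> Pol" for f
    using that by (simp add: irrelevant_eq euler_op_polys_in lookup_euler_op)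
  obtain h where h: "h \<in> lin_maps R \<Omega> E" "\<And>a. a \<in> carrier R \<Longrightarrow> h (K.d a) = D a"
  proof (rule K.universal[OF E_module, of D])
    show "D \<in> carrier R \<rightarrow> carrier E"
      by (auto simp: R_carrier D cl_irrelevant irr)
    show "D (a \<oplus>\<^bsub>R\<^esub> b) = D a \<oplus>\<^bsub>E\<^esub> D b" if "a \<in> carrier R" "b \<in> carrier R" for a b
      using that
      by (auto simp: R_carrier D cl_add[symmetric] polys_in_add euler_op_add euler_op_polys_in)
    show "D (a \<otimes>\<^bsub>R\<^esub> b) = a \<odot>\<^bsub>E\<^esub> D b \<oplus>\<^bsub>E\<^esub> b \<odot>\<^bsub>E\<^esub> D a"
      if "a \<in> carrier R" "b \<in> carrier R" for a b
      using that
      by (auto simp: R_carrier D cl_add[symmetric] cl_mult[symmetric] polys_in_mult euler_op_mult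
          euler_op_polys_in)
    show "D c = \<zero>\<^bsub>E\<^esub>" if "c \<in> cl ` range const" for c
      using that by (auto simp: D polys_in_const euler_op_const cl_zero)
  qed (auto simp: Omega_kaehler)
  have "h (dx n I i) = cl (X i)" if "i \<in> {0..n}" for i
    using that h(2)[of "cl (X i)"] by (simp add: dx_kaehler D polys_in_X euler_op_X)
  then show ?thesis using h(1) by blast
qed

lemma euler_form_props:
  "euler_form n I \<in> lin_maps R \<Omega> E" "i \<le> n \<Longrightarrow> euler_form n I (dx n I i) = cl (X i)"
proof -
  let ?P = "\<lambda>h. h \<in> lin_maps R \<Omega> E \<and> h \<in> extensional (carrier \<Omega>)
     \<and> (\<forall>i\<in>{0..n}. h (dx n I i) = cl (X i))"
  obtain h where h: "h \<in> lin_maps R \<Omega> E" "\<forall>i\<in>{0..n}. h (dx n I i) = cl (X i)"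
    using euler_form_exists by blast
  \<comment> \<open>The definite description ranges over extensional maps. Restriction supplies one,
    and surjectivity of \<open>gamma\<close> makes any two of them equal.\<close>
  have "restrict h (carrier \<Omega>) \<in> lin_maps R \<Omega> E"
    using h(1) unfolding lin_maps_def by (auto simp: Pi_iff)
  then have P: "?P (restrict h (carrier \<Omega>))"
    using h(2) by simp
  have "h1 = h2" if "?P h1" "?P h2" for h1 h2
  proof (rule extensionalityI[of _ "carrier \<Omega>"])
    fix x assume "x \<in> carrier \<Omega>"
    then obtain v where "v \<in> carrier V" "x = gamma n I v" using gamma_surj by blast
    then show "h1 x = h2 x"
      using that euler_linear_gamma[of h1 v] euler_linear_gamma[of h2 v] by simp
  qed (use that in auto)
  then have "\<exists>!h. ?P h" using P by blast
  from theI'[OF this] have "?P (euler_form n I)" unfolding euler_form_def .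
  then show "euler_form n I \<in> lin_maps R \<Omega> E" "i \<le> n \<Longrightarrow> euler_form n I (dx n I i) = cl (X i)"
    by auto
qed

lemma euler_linear: "linear_map R \<Omega> E (euler_form n I)"
  by (intro linear_map.intro linear_map_axioms.intro O.plain_module_axioms E_module euler_form_props)

lemma Ker_submodule: "submodule (Ker_euler n I) R \<Omega>"
  unfolding Ker_euler_def by (rule linear_map.kernel_submodule[OF euler_linear])

lemma gamma_in_Ker_iff:
  assumes v: "v \<in> carrier V"
  shows "gamma n I v \<in> Ker_euler n I \<longleftrightarrow> (\<Sum>i=0..n. v i * X i) \<in> I"
proof -
  have "(\<Sum>i=0..n. v i * X i) \<in> Pol" using sum_V[OF v subset_refl] by (simp add: irrelevant_eq)
  then show ?thesis
    using euler_linear_gamma[OF euler_form_props v] gamma_closed[OF v]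
    by (simp add: Ker_euler_def a_kernel_def' cl_eq_zero_iff)
qed

text \<open>On a generator the Euler form gives
  \<open>x\<^sub>i x\<^sub>j - x\<^sub>j x\<^sub>i\<close>, which vanishes by commutativity of
  \<open>R\<close>.\<close>

lemma koszul_le_Ker: "U \<subseteq> Ker_euler n I"
  unfolding koszul_def
proof (rule O.mod_span_least[OF Ker_submodule], safe)
  interpret \<epsilon>: linear_map R \<Omega> E "euler_form n I" by (rule euler_linear)
  fix i j :: nat assume ij: "i < j" "j \<le> n"
  have XP: "X i \<in> Pol" "X j \<in> Pol" using ij by (auto intro: polys_in_X)
  have e: "euler_form n I (cl (X k) \<odot>\<^bsub>\<Omega>\<^esub> dx n I l) = cl (X k) \<otimes>\<^bsub>R\<^esub> cl (X l)"
    if "k \<le> n" "l \<le> n" for k l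
    using that \<epsilon>.smult[of "cl (X k)" "dx n I l"] by (simp add: euler_form_props(2) polys_in_X)
  have "euler_form n I (cl (X i) \<odot>\<^bsub>\<Omega>\<^esub> dx n I j) = euler_form n I (cl (X j) \<odot>\<^bsub>\<Omega>\<^esub> dx n I i)"
    using ij XP by (simp add: e R.m_comm)
  moreover have c: "cl (X i) \<odot>\<^bsub>\<Omega>\<^esub> dx n I j \<in> carrier \<Omega>" "cl (X j) \<odot>\<^bsub>\<Omega>\<^esub> dx n I i \<in> carrier \<Omega>"
    using ij XP by auto
  ultimately have "euler_form n I (cl (X i) \<odot>\<^bsub>\<Omega>\<^esub> dx n I j \<ominus>\<^bsub>\<Omega>\<^esub> cl (X j) \<odot>\<^bsub>\<Omega>\<^esub> dx n I i) = \<zero>\<^bsub>E\<^esub>"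
    unfolding \<epsilon>.minus[OF c] using \<epsilon>.closed[OF c(1)] \<epsilon>.closed[OF c(2)]
    by (subst \<epsilon>.N.minus_eq_zero_iff) auto
  then show "cl (X i) \<odot>\<^bsub>\<Omega>\<^esub> dx n I j \<ominus>\<^bsub>\<Omega>\<^esub> cl (X j) \<odot>\<^bsub>\<Omega>\<^esub> dx n I i \<in> Ker_euler n I"
    using ij by (simp add: Ker_euler_def a_kernel_def' koszul_gen_closed)
qed

lemma gamma_theta_Ker: "F \<in> I \<Longrightarrow> gamma n I (theta n F) \<in> Ker_euler n I"
  using I_irrelevant by (subst gamma_in_Ker_iff) (auto simp: theta_V theta_sum)

lemma Ker_cases:
  assumes "\<omega> \<in> Ker_euler n I"
  obtains v where "v \<in> carrier V" "\<omega> = gamma n I v" "(\<Sum>i=0..n. v i * X i) \<in> I"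
    "eta n I \<omega> = delta n I (\<Sum>i=0..n. v i * X i)"
proof -
  have "\<omega> \<in> carrier \<Omega>" using assms O.submoduleE(1)[OF Ker_submodule] by blast
  then obtain v where "v \<in> carrier V" "\<omega> = gamma n I v" using gamma_surj by blast
  then show thesis using that assms gamma_in_Ker_iff eta_gamma by blast
qed

subsection \<open>The four assertions\<close>

lemma gamma_linear: "gamma n I \<in> lin_maps (PR n) V (restrict_scalars cl \<Omega>)"
  by (auto simp: lin_maps_def restrict_scalars_def gamma_closed gamma_add gamma_smult PR_carrier)

lemma delta_linear:
  "delta n I \<in> lin_maps (PR n) ((ring_module (PR n))\<lparr>carrier := irrelevant n\<rparr>)
     (restrict_scalars cl Q)"
  by (auto simp: lin_maps_def restrict_scalars_def delta_closed delta_add delta_smult PR_carrier)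

lemma delta_image:
  "delta n I ` I = carrier (quot_module (\<Omega>\<lparr>carrier := Ker_euler n I\<rparr>) U)"
proof -
  \<comment> \<open>Cosets depend on the addition alone, which the smaller carrier does not alter,
    so these are the cosets formed by \<open>eta\<close>.\<close>
  have "carrier (quot_module (\<Omega>\<lparr>carrier := Ker_euler n I\<rparr>) U) = eta n I ` Ker_euler n I"
    by (auto simp: quot_module_def A_RCOSETS_def' a_r_coset_def' eta_def)
  moreover have "delta n I ` I = eta n I ` Ker_euler n I"
  proof
    show "delta n I ` I \<subseteq> eta n I ` Ker_euler n I"
      by (auto simp: delta_def gamma_theta_Ker)
    show "eta n I ` Ker_euler n I \<subseteq> delta n I ` I"
      by (auto elim!: Ker_cases)
  qed
  ultimately show ?thesis by simp
qed

lemma Ker_euler_generators: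
  assumes S: "S \<subseteq> carrier (PR n)" and gen: "Idl\<^bsub>PR n\<^esub> S = I"
  shows "Ker_euler n I = U <+>\<^bsub>\<Omega>\<^esub> mod_span R \<Omega> ((gamma n I \<circ> theta n) ` S)"
    (is "_ = U <+>\<^bsub>\<Omega>\<^esub> ?N")
proof
  interpret P: cring "PR n :: 'k mpoly ring" by (rule PR_cring)
  have SI: "S \<subseteq> I" using P.genideal_self[OF S] gen by simp
  have gS: "(gamma n I \<circ> theta n) ` S \<subseteq> Ker_euler n I"
    using SI gamma_theta_Ker by auto
  then have N: "submodule ?N R \<Omega>"
    using O.submoduleE(1)[OF Ker_submodule] by (intro O.mod_span_submodule) blast
  let ?W = "U <+>\<^bsub>\<Omega>\<^esub> ?N"
  have W: "submodule ?W R \<Omega>" by (rule O.submodule_set_add[OF koszul_submodule N])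
  have "?N \<subseteq> Ker_euler n I" by (rule O.mod_span_least[OF Ker_submodule gS])
  then show "?W \<subseteq> Ker_euler n I"
    using koszul_le_Ker O.submoduleE(5)[OF Ker_submodule] by (auto simp: set_add_def')
  have UW: "U \<subseteq> ?W"
  proof
    fix u assume u: "u \<in> U"
    then have "u = u \<oplus>\<^bsub>\<Omega>\<^esub> \<zero>\<^bsub>\<Omega>\<^esub>" using O.submoduleE(1)[OF koszul_submodule] by auto
    then show "u \<in> ?W" unfolding set_add_def' using u O.submodule_zero[OF N] by blast
  qed
  have NW: "?N \<subseteq> ?W"
  proof
    fix x assume x: "x \<in> ?N"
    then have "x = \<zero>\<^bsub>\<Omega>\<^esub> \<oplus>\<^bsub>\<Omega>\<^esub> x" using O.submoduleE(1)[OF N] by auto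
    then show "x \<in> ?W"
      unfolding set_add_def' using x O.submodule_zero[OF koszul_submodule] by blast
  qed
  \<comment> \<open>\<open>?W\<close> contains \<open>U\<close>, so membership in it may be tested
    after applying \<open>eta\<close>.\<close>
  have W_cong: "x \<in> ?W" if xy: "x \<in> carrier \<Omega>" "y \<in> ?W" "eta n I x = eta n I y" for x y
  proof -
    have yc: "y \<in> carrier \<Omega>" using xy(2) O.submoduleE(1)[OF W] by blast
    have "x \<ominus>\<^bsub>\<Omega>\<^esub> y \<in> ?W"
      using xy(3) Kz.proj_eq_iff[OF xy(1) yc] UW unfolding eta_proj by blast
    then have "(x \<ominus>\<^bsub>\<Omega>\<^esub> y) \<oplus>\<^bsub>\<Omega>\<^esub> y \<in> ?W" using xy(2) by (rule O.submoduleE(5)[OF W])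
    then show ?thesis using xy(1) yc by (simp add: a_minus_def O.M.a_assoc O.M.l_neg)
  qed
  \<comment> \<open>\<open>?T\<close> is an ideal although \<open>theta\<close> is not
    \<open>P\<close>-linear: membership in \<open>?W\<close> depends only on classes modulo
    \<open>U\<close>, and there \<open>delta\<close> is linear. As \<open>?T\<close> contains the
    generators, it contains \<open>I\<close>.\<close>
  let ?T = "{F \<in> irrelevant n. gamma n I (theta n F) \<in> ?W}"
  have mult: "f * F \<in> ?T" if f: "f \<in> Pol" and F: "F \<in> ?T" for f F
  proof -
    have Fi: "F \<in> irrelevant n" and FW: "gamma n I (theta n F) \<in> ?W" using F by auto
    have "eta n I (gamma n I (theta n (f * F))) = eta n I (cl f \<odot>\<^bsub>\<Omega>\<^esub> gamma n I (theta n F))"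
      using delta_smult[OF f Fi] linear_map.smult[OF eta_linear cl_closed[OF f] gamma_theta_closed[OF Fi]]
      by (simp add: delta_def)
    then show ?thesis
      using W_cong O.submoduleE(4)[OF W cl_closed[OF f] FW] irrelevant_mult[OF f Fi]
        gamma_theta_closed by blast
  qed
  have "ideal ?T (PR n)"
  proof (rule idealI[OF P.ring_axioms])
    show "subgroup ?T (add_monoid (PR n))"
    proof (rule P.add.subgroupI)
      show "?T \<subseteq> carrier (PR n)" by (auto simp: irrelevant_eq PR_carrier)
      have "gamma n I (theta n 0) = gamma n I (\<lambda>i. 0)"
        using I_zero I_irrelevant by (auto simp: theta_eq)
      also have "\<dots> = \<zero>\<^bsub>\<Omega>\<^esub>" by (rule gamma_zero)
      finally have "0 \<in> ?T" using O.submodule_zero[OF W] I_zero I_irrelevant by auto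
      then show "?T \<noteq> {}" by blast
    next
      fix F assume F: "F \<in> ?T"
      then have "F \<in> carrier (PR n)" by (auto simp: irrelevant_eq PR_carrier)
      moreover have "(- 1) * F \<in> ?T" by (rule mult[OF _ F]) (intro polys_in_uminus polys_in_one)
      ultimately show "\<ominus>\<^bsub>PR n\<^esub> F \<in> ?T"
        by (simp add: PR_uminus)
    next
      fix F G assume "F \<in> ?T" "G \<in> ?T"
      then show "F \<oplus>\<^bsub>PR n\<^esub> G \<in> ?T"
        using O.submoduleE(5)[OF W] by (simp add: gamma_theta_add irrelevant_add)
    qed
  next
    fix F f :: "'k mpoly" assume "F \<in> ?T" "f \<in> carrier (PR n)"
    then show "f \<otimes>\<^bsub>PR n\<^esub> F \<in> ?T" "F \<otimes>\<^bsub>PR n\<^esub> f \<in> ?T"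
      using mult[of f F] by (simp_all add: PR_carrier mult.commute)
  qed
  moreover have "S \<subseteq> ?T"
    using SI I_irrelevant NW O.mod_span_superset[of "(gamma n I \<circ> theta n) ` S"] by auto
  ultimately have IT: "I \<subseteq> ?T"
    using P.genideal_minimal gen by blast
  show "Ker_euler n I \<subseteq> ?W"
  proof
    fix \<omega> assume "\<omega> \<in> Ker_euler n I"
    then obtain F where F: "F \<in> I" "eta n I \<omega> = delta n I F" by (rule Ker_cases) blast
    moreover have "\<omega> \<in> carrier \<Omega>" using \<open>\<omega> \<in> _\<close> O.submoduleE(1)[OF Ker_submodule] by blast
    ultimately show "\<omega> \<in> ?W" using W_cong[of \<omega> "gamma n I (theta n F)"] IT by (auto simp: delta_def)
  qed
qed

text \<open>Membership in the irrelevant ideal is carried through the induction because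
  \<open>delta_add\<close> asks for it in the sum case.\<close>

lemma delta_ideal_prod:
  assumes "F \<in> ideal_prod (PR n) (irrelevant n) I"
  shows "F \<in> irrelevant n \<and> delta n I F = \<zero>\<^bsub>Q\<^esub>"
  using assms
proof (induction F rule: ideal_prod.induct)
  case (prod G F)
  have F: "F \<in> irrelevant n" "F \<in> Pol" using prod(2) I_irrelevant I_Pol by auto
  have G: "theta n G \<in> carrier V" using prod(1) by (rule theta_V)
  have "F * G = (\<Sum>i=0..n. F * theta n G i * X i)"
    by (subst theta_sum[OF prod(1), symmetric]) (simp add: sum_distrib_left mult.assoc)
  then have "delta n I (F * G) = eta n I (cl F \<odot>\<^bsub>\<Omega>\<^esub> gamma n I (theta n G))"
    using eta_gamma[OF V_smult[OF F(2) G]] gamma_smult[OF F(2) G] by simp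
  also have "cl F = \<zero>\<^bsub>R\<^esub>" using F(2) prod(2) by (simp add: cl_eq_zero_iff)
  finally have "delta n I (F * G) = \<zero>\<^bsub>Q\<^esub>"
    using gamma_closed[OF G] linear_map.zero[OF eta_linear] by (simp add: O.smult_l_null)
  moreover have "F * G \<in> irrelevant n" using F(2) prod(1) by (rule irrelevant_mult)
  ultimately show ?case by (simp add: mult.commute)
next
  case (sum F G)
  interpret Q: plain_module R Q by (rule Kz.quot_plain_module)
  show ?case using sum by (simp add: irrelevant_add delta_add)
qed

text \<open>An element outside the product would make \<open>i\<close> a degree of a minimal
  generator. That \<open>i\<close> is then at most the \<open>Max\<close> needs the finiteness from
  \<open>finite_min_gen_degrees\<close>.\<close>

lemma homogeneous_in_ideal_prod:
  assumes i: "i > max_gen_degree n I" and F: "F \<in> I" "homogeneous i F"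
  shows "F \<in> ideal_prod (PR n) (irrelevant n) I"
proof (rule ccontr)
  interpret P: cring "PR n :: 'k mpoly ring" by (rule PR_cring)
  let ?J = "ideal_prod (PR n) (irrelevant n) I"
  assume "F \<notin> ?J"
  have M: "ideal (irrelevant n :: 'k mpoly set) (PR n)"
    unfolding irrelevant_def by (rule P.genideal_ideal) (auto simp: PR_carrier polys_in_X)
  interpret J: ideal ?J "PR n" by (rule P.ideal_prod_is_ideal[OF M ideal_I])
  let ?D = "{d. min_gens_deg n I d \<noteq> {\<zero>\<^bsub>min_gens_module n I\<^esub>}}"
  have coset: "?J +>\<^bsub>PR n\<^esub> f = ?J \<longleftrightarrow> f \<in> ?J" if "f \<in> I" for f
    using that I_Pol J.a_rcos_self[of f] P.a_coset_join2[OF _ J.a_subgroup, of f]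
    by (auto simp: PR_carrier)
  have zero: "\<zero>\<^bsub>min_gens_module n I\<^esub> = ?J" by (simp add: min_gens_module_def quot_module_def)
  \<comment> \<open>The zero polynomial is homogeneous of every degree, so a graded piece is never
    empty, and differing from the zero piece means having a nonzero element.\<close>
  have ne: "min_gens_deg n I d \<noteq> {}" for d
    using I_zero by (auto simp: min_gens_deg_def intro: homogeneous_zero)
  have "?D \<subseteq> {d. \<exists>f\<in>I. homogeneous d f \<and> f \<notin> ?J}"
  proof
    fix d assume "d \<in> ?D"
    then have "\<not> min_gens_deg n I d \<subseteq> {?J}"
      using ne[of d] unfolding zero subset_singleton_iff by simp
    then obtain f where "f \<in> I" "homogeneous d f" "?J +>\<^bsub>PR n\<^esub> f \<noteq> ?J"
      unfolding min_gens_deg_def by blast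
    then show "d \<in> {d. \<exists>f\<in>I. homogeneous d f \<and> f \<notin> ?J}" using coset[of f] by blast
  qed
  then have "finite ?D" using finite_min_gen_degrees[OF ideal_I] by (rule finite_subset)
  moreover have "?J +>\<^bsub>PR n\<^esub> F \<in> min_gens_deg n I i" using F by (auto simp: min_gens_deg_def)
  then have "i \<in> ?D" using \<open>F \<notin> ?J\<close> coset[OF F(1)] zero by auto
  ultimately have "i \<le> max_gen_degree n I" unfolding max_gen_degree_def by (rule Max_ge)
  then show False using i by simp
qed

lemma koszul_eq_Ker_degree:
  assumes i: "i > max_gen_degree n I"
  shows "U \<inter> Omega_deg n I i = Ker_euler n I \<inter> Omega_deg n I i"
proof
  show "U \<inter> Omega_deg n I i \<subseteq> Ker_euler n I \<inter> Omega_deg n I i" using koszul_le_Ker by blast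
  show "Ker_euler n I \<inter> Omega_deg n I i \<subseteq> U \<inter> Omega_deg n I i"
  proof safe
    fix \<omega> assume \<omega>: "\<omega> \<in> Ker_euler n I" "\<omega> \<in> Omega_deg n I i"
    \<comment> \<open>As \<open>i\<close> exceeds a natural number it is positive. The coefficients
      of the \<open>dx n I j\<close> have degree \<open>d\<close>, one less than \<open>i\<close>,
      because each \<open>dx n I j\<close> has degree one.\<close>
    obtain d where d: "i = Suc d" using i by (cases i) auto
    obtain r where r: "\<omega> = finsum \<Omega> (\<lambda>j. r j \<odot>\<^bsub>\<Omega>\<^esub> dx n I j) {0..n}"
        "\<forall>j\<in>{0..n}. r j \<in> coord_deg n I d"
      using \<omega>(2) by (auto simp: Omega_deg_def d)
    then have "\<forall>j\<in>{0..n}. \<exists>f. f \<in> Pol \<and> homogeneous d f \<and> r j = cl f"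
      by (auto simp: coord_deg_def PR_carrier)
    then obtain g where g: "\<And>j. j \<in> {0..n} \<Longrightarrow> g j \<in> Pol \<and> homogeneous d (g j) \<and> r j = cl (g j)"
      by metis
    define v where "v = (\<lambda>j. if j \<le> n then g j else 0)"
    have v: "v \<in> carrier V" "\<And>j. homogeneous d (v j)"
      using g by (auto simp: V_carrier v_def polys_in_zero homogeneous_zero)
    have \<omega>v: "\<omega> = gamma n I v"
      unfolding r(1) gamma_def using v(1) g
      by (intro O.M.finsum_cong') (auto simp: v_def V_carrier)
    let ?F = "\<Sum>i=0..n. v i * X i"
    have "?F \<in> I" using \<omega>(1) gamma_in_Ker_iff[OF v(1)] \<omega>v by simp
    \<comment> \<open>The factors \<open>X i\<close> restore the missing degree, so
      \<open>?F\<close> is homogeneous of degree exactly \<open>i\<close> and the degree bound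
      applies to it.\<close>
    moreover have "homogeneous i ?F"
      unfolding d using homogeneous_mult[OF v(2) homogeneous_X] by (intro homogeneous_sum) simp
    ultimately have "delta n I ?F = \<zero>\<^bsub>Q\<^esub>"
      using delta_ideal_prod homogeneous_in_ideal_prod[OF i] by blast
    then have "eta n I \<omega> = \<zero>\<^bsub>Q\<^esub>" using eta_gamma[OF v(1)] \<omega>v by simp
    then show "\<omega> \<in> U"
      using gamma_closed[OF v(1)] \<omega>v unfolding eta_proj by (simp add: Kz.proj_eq_zero_iff)
  qed
qed

end

section \<open>From zero-dimensional subschemes to the algebraic setting\<close>

lemma zero_dim_subscheme_proj_scheme:
  fixes I :: "'k::field mpoly set"
  assumes "zero_dim_subscheme n I"
  shows "proj_scheme n I"
proof
  show hom: "homogeneous_ideal n I" using assms by (simp add: zero_dim_subscheme_def)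
  interpret P: cring "PR n :: 'k mpoly ring" by (rule PR_cring)
  interpret I: ideal I "PR n" using hom by (simp add: homogeneous_ideal_def)
  \<comment> \<open>The unit ideal has no points, and the supremum over the empty set of chains is
    \<open>- \<infinity>\<close>, not zero.\<close>
  have one: "1 \<notin> I"
  proof
    assume "1 \<in> I"
    have "proj_points n I = {}"
    proof (rule ccontr)
      assume "proj_points n I \<noteq> {}"
      then obtain p where p: "primeideal p (PR n)" "I \<subseteq> p" by (auto simp: proj_points_def)
      interpret p: primeideal p "PR n" by (rule p(1))
      show False using p.I_notcarr p.one_imp_carrier p(2) \<open>1 \<in> I\<close> by auto
    qed
    then have no_chain: "{l :: nat. \<exists>p. (\<forall>i\<le>l. p i \<in> proj_points n I) \<and> (\<forall>i<l. p i \<subset> p (Suc i))} = {}"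
      by blast
    have "proj_dim n I = - \<infinity>"
      unfolding proj_dim_def no_chain by (simp add: bot_ereal_def)
    then show False using assms by (simp add: zero_dim_subscheme_def)
  qed
  show "I \<subseteq> irrelevant n"
  proof
    fix f assume f: "f \<in> I"
    then have fP: "f \<in> polys_in {0..n}" using I.a_subset by (auto simp: PR_carrier)
    \<comment> \<open>The constant term is the component of degree zero and so lies in
      \<open>I\<close>. If it were nonzero it would be a unit, which a proper ideal cannot
      contain.\<close>
    have "hom_comp 0 f = const (lookup f 0)"
      by (rule poly_mapping_eqI)
        (auto simp: lookup_hom_comp const_def lookup_single when_def mdeg_eq_zero_iff)
    then have c: "const (lookup f 0) \<in> I" using f hom by (metis homogeneous_ideal_def)
    have "const (inverse (lookup f 0)) \<otimes>\<^bsub>PR n\<^esub> const (lookup f 0) \<in> I"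
      by (rule I.I_l_closed[OF c]) (simp add: PR_carrier polys_in_const)
    then have "lookup f 0 \<noteq> 0 \<Longrightarrow> 1 \<in> I" by (simp add: const_def mult_single)
    then show "f \<in> irrelevant n" using one fP by (auto simp: irrelevant_eq)
  qed
qed

theorem proposition4p6:
  fixes n :: nat and I :: "'k::field mpoly set"
  assumes perfect: "is_perfect_field TYPE('k)"
    and n: "n \<ge> 1"
    and zero_dim: "zero_dim_subscheme n I"
    and no_point_at_infinity: "\<forall>p\<in>proj_points n I. X 0 \<notin> p"
  shows
    \<comment> \<open>(a)\<close>
    "(gamma n I \<in> lin_maps (PR n) (free_module (PR n) {0..n})
          (restrict_scalars (cls n I) (Omega n I))
      \<and> gamma n I ` carrier (free_module (PR n) {0..n}) = carrier (Omega n I)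
      \<and> (\<forall>i\<in>{0..n}. gamma n I (basis_vec (PR n) i) = dx n I i)
      \<and> delta n I \<in> lin_maps (PR n) ((ring_module (PR n))\<lparr>carrier := irrelevant n\<rparr>)
          (restrict_scalars (cls n I) (Omega_mod_koszul n I)))
    \<comment> \<open>(b)\<close>
    \<and> delta n I ` I
        = carrier (quot_module ((Omega n I)\<lparr>carrier := Ker_euler n I\<rparr>) (koszul n I))
    \<comment> \<open>(c)\<close>
    \<and> (\<forall>(r::nat) G. (\<forall>k\<in>{1..r}. \<exists>d. homogeneous d (G k)) \<and> G ` {1..r} \<subseteq> carrier (PR n)
          \<and> Idl\<^bsub>PR n\<^esub> (G ` {1..r}) = I
        \<longrightarrow> Ker_euler n I = koszul n I <+>\<^bsub>Omega n I\<^esub>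
              mod_span (coord_ring n I) (Omega n I) ((gamma n I \<circ> theta n) ` G ` {1..r}))
    \<comment> \<open>(d)\<close>
    \<and> (\<forall>i > max_gen_degree n I. koszul n I \<inter> Omega_deg n I i = Ker_euler n I \<inter> Omega_deg n I i)"
proof -
  interpret proj_scheme n I by (rule zero_dim_subscheme_proj_scheme[OF zero_dim])
  show ?thesis
    using gamma_linear gamma_surj gamma_basis_vec delta_linear delta_image
      Ker_euler_generators koszul_eq_Ker_degree
    by auto
qed

end
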